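(* Let $\Gamma$ be a countable discrete infinite group. With the notation introduced in the context: (1) $\mathcal{F}_R=\mathcal{F}_{RTF}$; in particular $\mathcal{F}_{RTF}$ is a filter. (2) $\mathcal{F}_L=\mathcal{F}_{LTF}$; in particular $\mathcal{F}_{LTF}$ is a filter. (3) $\mathcal{F}=\mathcal{F}_{TF}=\mathcal{F}_{RTF}\cap\mathcal{F}_{LTF}$, hence $$\mathcal{I}_{TF}=\mathcal{I}_{LTF}\cap\mathcal{I}_{RTF}=\mathcal{I}_L\cap\mathcal{I}_R=\mathcal{I}=\mathcal{I}_W=\mathcal{I}_{IW}.$$
   Context: $\Gamma$ is a countable discrete infinite group. $\beta\Gamma$ is the Čech–Stone compactification of $\Gamma$, viewed as the space of ultrafilters on $\Gamma$, with $\gamma\in\Gamma$ identified with the principal ultrafilter $\{A\subset\Gamma:\gamma\in A\}$. For $A\subset\Gamma$, the closure of $A$ in $\beta\Gamma$ is $\mathrm{cls}_{\beta\Gamma}A=\{p\in\beta\Gamma: A\in p\}$. Let $X=\beta\Gamma\setminus\Gamma$. For $A\subset\Gamma$ and $\gamma\in\Gamma$ put $A\gamma^{-1}=\{a\gamma^{-1}:a\in A\}$ and $\gamma^{-1}A=\{\gamma^{-1}a:a\in A\}$; $A^c=\Gamma\setminus A$. Two products on $\beta\Gamma$ extend the product of $\Gamma$: for $p,q\in\beta\Gamma$, $$pq=\{A\subset\Gamma:\{\alpha\in\Gamma:\alpha^{-1}A\in q\}\in p\},\qquad p\cdot q=\{A\subset\Gamma:\{\alpha\in\Gamma:A\alpha^{-1}\in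 p\}\in q\}.$$ The first makes $\beta\Gamma$ a right topological semigroup (for each fixed $q$ the map $p\mapsto pq$ is continuous); the second makes it a left topological semigroup (for each fixed $q$ the map $p\mapsto q\cdot p$ is continuous). $X$ is a subsemigroup for both products. Let $Z_R$ be the closure in $\beta\Gamma$ of $\{pq:p,q\in X\}$, let $Z_L$ be the closure in $\beta\Gamma$ of $\{p\cdot q:p,q\in X\}$, and let $Z=Z_R\cup Z_L$. Define $\mathcal{I}_R=\{A\subset\Gamma:\mathrm{cls}_{\beta\Gamma}A\cap Z_R=\emptyset\}$ and $\mathcal{F}_R=\{B\subset\Gamma:B^c\in\mathcal{I}_R\}=\{B\subset\Gamma:\mathrm{cls}_{\beta\Gamma}B\supset Z_R\}$. Define $\mathcal{I}_L,\mathcal{F}_L$ in the same way with $Z_L$ in place of $Z_R$, and $\mathcal{I},\mathcal{F}$ in the same way with $Z$ in place of $Z_R$. A set $A\subset\Gamma$ is right translation-finite (RTF) if for every infinite $D\subset\Gamma$ there is a finite $F\subset D$ such that $\bigcap_{\delta\in F}A\delta^{-1}$ is finite. It is left translation-finite (LTF) if for every infinite $D\subset\Gamma$ there is a finite $F\subset D$ such that $\bigcap_{\delta\in F}\delta^{-1}A$ is finite. (The intersection over the empty set is taken to be $\Gamma$.) $\mathcal{I}_{RTF}$ and $\mathcal{I}_{LTF}$ are the collections of RTF and of LTF subsets of $\Gamma$, and $\mathcal{I}_{TF}=\mathcal{I}_{LTF}\cap\mathcal{I}_{RTF}$ is the collection of translation-finite (TF) sets. $\mathcal{F}_{RTF},\mathcal{F}_{LTF},\mathcal{F}_{TF}$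 are the collections of complements in $\Gamma$ of members of $\mathcal{I}_{RTF},\mathcal{I}_{LTF},\mathcal{I}_{TF}$ respectively. A function $f\in\ell_\infty(\Gamma)$ (bounded complex-valued) is weakly almost periodic if its orbit under translations by elements of $\Gamma$ is weakly precompact in the Banach space $\ell_\infty(\Gamma)$; $WAP(\Gamma)$ is the $C^*$-algebra of such functions and $\Gamma^{WAP}$ is its Gelfand (maximal ideal) space. $\Gamma^{WAP}$ is the universal semitopological semigroup compactification of $\Gamma$ (its multiplication extends that of $\Gamma$ and is separately continuous), and $\Gamma$ is regarded as a dense discrete subset of $\Gamma^{WAP}$. Let $Y=\Gamma^{WAP}\setminus\Gamma$ and $Y^2=\{yz:y,z\in Y\}$. $\mathcal{I}_W$ is the collection of sets $A\subset\Gamma$ whose closure in $\Gamma^{WAP}$ is an open subset of $\Gamma^{WAP}$ that is disjoint from the closure of $Y^2$ in $\Gamma^{WAP}$. $\mathcal{I}_{IW}$ is the collection of sets $A\subset\Gamma$ whose closure in $\Gamma^{WAP}$ is an open subset of $\Gamma^{WAP}$ homeomorphic to $\beta A$, the Čech–Stone compactification of the discrete set $A$.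
   Formalization: Parts (1) and (2) are proved with RTF and LTF interchanged: F_R = F_LTF and F_L = F_RTF (both filters). With the stated definitions the original equalities fail, e.g. for A = {d_n x_m : n < m} in a free group on generators d_n, x_m. *)

theory Defs
  imports "HOL-Analysis.Analysis"
begin

text \<open>
  The countable discrete group \<open>\<Gamma>\<close> is a type of sort
  \<open>{group_add, countable, discrete_topology}\<close>. The class \<open>group_add\<close> does not assume
  commutativity; only the notation is additive, so that \<open>\<alpha> + \<beta>\<close> is the product
  \<open>\<alpha>\<beta>\<close>, and \<open>- \<alpha>\<close> is the inverse of \<open>\<alpha>\<close>.
\<close>

section \<open>Translates and translation-finite sets\<close>

text \<open>\<open>left_translate \<gamma> A\<close> is \<open>\<gamma>\<inverse>A\<close> and \<open>right_translate \<gamma> A\<close> is \<open>A\<gamma>\<inverse>\<close>.\<close>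

definition left_translate :: "'a::group_add \<Rightarrow> 'a set \<Rightarrow> 'a set" where
  "left_translate \<gamma> A = (\<lambda>a. - \<gamma> + a) ` A"

definition right_translate :: "'a::group_add \<Rightarrow> 'a set \<Rightarrow> 'a set" where
  "right_translate \<gamma> A = (\<lambda>a. a - \<gamma>) ` A"

definition RTF :: "'a::group_add set \<Rightarrow> bool" where
  "RTF A \<longleftrightarrow> (\<forall>D. infinite D \<longrightarrow>
     (\<exists>F. finite F \<and> F \<subseteq> D \<and> finite (\<Inter>\<delta>\<in>F. right_translate \<delta> A)))"

definition LTF :: "'a::group_add set \<Rightarrow> bool" where
  "LTF A \<longleftrightarrow> (\<forall>D. infinite D \<longrightarrow>
     (\<exists>F. finite F \<and> F \<subseteq> D \<and> finite (\<Inter>\<delta>\<in>F. left_translate \<delta> A)))"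

definition I_RTF :: "'a::group_add set set" where "I_RTF = {A. RTF A}"
definition I_LTF :: "'a::group_add set set" where "I_LTF = {A. LTF A}"
definition I_TF :: "'a::group_add set set" where "I_TF = I_LTF \<inter> I_RTF"

definition F_RTF :: "'a::group_add set set" where "F_RTF = {B. - B \<in> I_RTF}"
definition F_LTF :: "'a::group_add set set" where "F_LTF = {B. - B \<in> I_LTF}"
definition F_TF :: "'a::group_add set set" where "F_TF = {B. - B \<in> I_TF}"

section \<open>The Cech-Stone compactification of a discrete set\<close>

definition set_filter :: "'a set \<Rightarrow> 'a set set \<Rightarrow> bool" where
  "set_filter S F \<longleftrightarrow> F \<subseteq> Pow S \<and> S \<in> F \<and> {} \<notin> F \<and>
     (\<forall>A\<in>F. \<forall>B\<in>F. A \<inter> B \<in> F) \<and> (\<forall>A\<in>F. \<forall>B. A \<subseteq> B \<and> B \<subseteq> S \<longrightarrow> B \<in> F)"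

definition set_ultrafilter :: "'a set \<Rightarrow> 'a set set \<Rightarrow> bool" where
  "set_ultrafilter S p \<longleftrightarrow> set_filter S p \<and> (\<forall>A. A \<subseteq> S \<longrightarrow> A \<in> p \<or> S - A \<in> p)"

definition beta :: "'a set \<Rightarrow> 'a set set set" where
  "beta S = {p. set_ultrafilter S p}"

definition beta_cls :: "'a set \<Rightarrow> 'a set \<Rightarrow> 'a set set set" where
  "beta_cls S A = {p \<in> beta S. A \<in> p}"

definition beta_topology :: "'a set \<Rightarrow> 'a set set topology" where
  "beta_topology S = topology_generated_by (beta_cls S ` Pow S)"

definition principal_ultrafilter :: "'a \<Rightarrow> 'a set set" where
  "principal_ultrafilter \<gamma> = {A. \<gamma> \<in> A}"

definition X_corona :: "'a set set set" where
  "X_corona = beta UNIV - range principal_ultrafilter"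

text \<open>
  The two products \<open>pq\<close> and \<open>p\<cdot>q\<close>; the first is continuous in \<open>p\<close>, the second
  in \<open>q\<close>. Note the crossing of sides: \<open>A \<in> pq\<close> means that \<open>\<alpha>\<inverse>A \<in> q\<close> for
  \<open>p\<close>-many \<open>\<alpha>\<close>. So the right topological product \<open>pq\<close>, hence \<open>Z_R\<close>, is governed by the
  left translates of \<open>A\<close>, i.e. by \<open>LTF\<close>, and \<open>Z_L\<close> by \<open>RTF\<close>.
\<close>

definition prod_R :: "'a::group_add set set \<Rightarrow> 'a set set \<Rightarrow> 'a set set" where
  "prod_R p q = {A. {\<alpha>. left_translate \<alpha> A \<in> q} \<in> p}"

definition prod_L :: "'a::group_add set set \<Rightarrow> 'a set set \<Rightarrow> 'a set set" where
  "prod_L p q = {A. {\<alpha>. right_translate \<alpha> A \<in> p} \<in> q}"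

definition Z_R :: "'a::group_add set set set" where
  "Z_R = beta_topology UNIV closure_of {prod_R p q | p q. p \<in> X_corona \<and> q \<in> X_corona}"

definition Z_L :: "'a::group_add set set set" where
  "Z_L = beta_topology UNIV closure_of {prod_L p q | p q. p \<in> X_corona \<and> q \<in> X_corona}"

definition Z_RL :: "'a::group_add set set set" where
  "Z_RL = Z_R \<union> Z_L"

definition I_R :: "'a::group_add set set" where "I_R = {A. beta_cls UNIV A \<inter> Z_R = {}}"
definition I_L :: "'a::group_add set set" where "I_L = {A. beta_cls UNIV A \<inter> Z_L = {}}"
definition I_RL :: "'a::group_add set set" where "I_RL = {A. beta_cls UNIV A \<inter> Z_RL = {}}"

definition F_R :: "'a::group_add set set" where "F_R = {B. - B \<in> I_R}"
definition F_L :: "'a::group_add set set" where "F_L = {B. - B \<in> I_L}"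
definition F_RL :: "'a::group_add set set" where "F_RL = {B. - B \<in> I_RL}"

section \<open>Weakly almost periodic functions\<close>

text \<open>
  As \<open>\<Gamma>\<close> is discrete, the Banach space of bounded continuous functions on it is
  \<open>\<ell>\<^sub>\<infinity>(\<Gamma>)\<close> with the supremum norm.
\<close>

type_synonym 'a linf = "'a \<Rightarrow>\<^sub>C complex"

lemma bcontfun_discrete_iff:
  fixes f :: "'a::discrete_topology \<Rightarrow> 'b::metric_space"
  shows "f \<in> bcontfun \<longleftrightarrow> bounded (range f)"
  by (simp add: bcontfun_def)

definition linf_mult ::
    "('a::discrete_topology) linf \<Rightarrow> 'a linf \<Rightarrow> 'a linf" where
  "linf_mult f g = Bcontfun (\<lambda>x. f x * g x)"

lemma apply_linf_mult [simp]: "apply_bcontfun (linf_mult f g) x = f x * g x"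
proof -
  have "norm (f x * g x) \<le> norm f * norm g" for x
    by (auto simp: norm_mult norm_bounded intro!: mult_mono)
  then have "(\<lambda>x. f x * g x) \<in> bcontfun"
    by (auto simp: bcontfun_discrete_iff bounded_iff)
  then show ?thesis
    by (simp add: linf_mult_def Bcontfun_inverse)
qed

definition linf_cscale :: "complex \<Rightarrow> ('a::discrete_topology) linf \<Rightarrow> 'a linf" where
  "linf_cscale c f = linf_mult (const_bcontfun c) f"

text \<open>\<open>(L\<^sub>\<gamma> f)(x) = f(\<gamma>x)\<close> and \<open>(R\<^sub>\<gamma> f)(x) = f(x\<gamma>)\<close>.\<close>

definition linf_L ::
    "'a \<Rightarrow> ('a::{group_add,discrete_topology}) linf \<Rightarrow> 'a linf" where
  "linf_L \<gamma> f = Bcontfun (\<lambda>x. f (\<gamma> + x))"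

definition linf_R ::
    "'a \<Rightarrow> ('a::{group_add,discrete_topology}) linf \<Rightarrow> 'a linf" where
  "linf_R \<gamma> f = Bcontfun (\<lambda>x. f (x + \<gamma>))"

lemma apply_linf_compose:
  fixes f :: "('a::discrete_topology) linf" and h :: "'a \<Rightarrow> 'a"
  shows "apply_bcontfun (Bcontfun (\<lambda>x. f (h x))) y = f (h y)"
proof -
  have "(\<lambda>x. f (h x)) \<in> bcontfun"
    by (auto simp: bcontfun_discrete_iff bounded_iff norm_bounded intro!: exI[of _ "norm f"])
  then show ?thesis by (simp add: Bcontfun_inverse)
qed

lemma apply_linf_L [simp]: "apply_bcontfun (linf_L \<gamma> f) x = f (\<gamma> + x)"
  by (simp add: linf_L_def apply_linf_compose)

lemma apply_linf_R [simp]: "apply_bcontfun (linf_R \<gamma> f) x = f (x + \<gamma>)"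
  by (simp add: linf_R_def apply_linf_compose)

text \<open>The continuous complex-linear functionals on \<open>\<ell>\<^sub>\<infinity>(\<Gamma>)\<close>.\<close>

definition linf_dual :: "(('a::discrete_topology) linf \<Rightarrow> complex) set" where
  "linf_dual = {\<phi>. bounded_linear \<phi> \<and> (\<forall>c f. \<phi> (linf_cscale c f) = c * \<phi> f)}"

definition linf_weak :: "('a::discrete_topology) linf topology" where
  "linf_weak = topology_generated_by {\<phi> -` U | \<phi> U. \<phi> \<in> linf_dual \<and> open U}"

text \<open>
  Orbits are taken under right translation. By Grothendieck's double limit criterion
  the orbit under left translation gives the same class of functions.
\<close>

definition WAP :: "('a::{group_add,discrete_topology}) linf set" where
  "WAP = {f. compactin linf_weak (linf_weak closure_of range (\<lambda>\<gamma>. linf_R \<gamma> f))}"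

section \<open>The weakly almost periodic compactification\<close>

text \<open>
  The Gelfand space of \<open>WAP(\<Gamma>)\<close>: the nonzero multiplicative linear functionals with the
  topology of pointwise convergence on \<open>WAP(\<Gamma>)\<close>. Functionals are restricted to
  \<open>WAP(\<Gamma>)\<close> (value \<open>undefined\<close> elsewhere), so that equal functionals are equal as
  HOL functions.
\<close>

definition wap_space ::
    "(('a::{group_add,discrete_topology}) linf \<Rightarrow> complex) set" where
  "wap_space = {\<xi> \<in> extensional WAP.
     (\<exists>f\<in>WAP. \<xi> f \<noteq> 0) \<and>
     (\<forall>f\<in>WAP. \<forall>g\<in>WAP. \<xi> (f + g) = \<xi> f + \<xi> g) \<and>
     (\<forall>c. \<forall>f\<in>WAP. \<xi> (linf_cscale c f) = c * \<xi> f) \<and>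
     (\<forall>f\<in>WAP. \<forall>g\<in>WAP. \<xi> (linf_mult f g) = \<xi> f * \<xi> g)}"

definition wap_topology ::
    "(('a::{group_add,discrete_topology}) linf \<Rightarrow> complex) topology" where
  "wap_topology = subtopology (product_topology (\<lambda>_. euclidean) WAP) wap_space"

definition wap_point ::
    "'a \<Rightarrow> ('a::{group_add,discrete_topology}) linf \<Rightarrow> complex" where
  "wap_point \<gamma> = (\<lambda>f\<in>WAP. apply_bcontfun f \<gamma>)"

text \<open>
  The multiplication of \<open>\<Gamma>\<^sup>W\<^sup>A\<^sup>P\<close> is \<open>(\<psi>\<xi>)(f) = \<psi>(s \<mapsto> \<xi>(L\<^sub>s f))\<close>. It extends the product of
  \<open>\<Gamma>\<close> (lemma \<open>wap_mult_point\<close>). It is the only separately continuous extension, since such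
  an extension satisfies
  \<open>(\<psi>\<xi>)(f) = lim\<^bsub>s\<rightarrow>\<psi>\<^esub> lim\<^bsub>t\<rightarrow>\<xi>\<^esub> f(st) = lim\<^bsub>s\<rightarrow>\<psi>\<^esub> \<xi>(L\<^sub>s f)\<close>, with \<open>s\<close>, \<open>t\<close> ranging over \<open>\<Gamma>\<close>.
\<close>

definition wap_mult ::
    "(('a::{group_add,discrete_topology}) linf \<Rightarrow> complex) \<Rightarrow> ('a linf \<Rightarrow> complex) \<Rightarrow>
     ('a linf \<Rightarrow> complex)" where
  "wap_mult \<psi> \<xi> = (\<lambda>f\<in>WAP. \<psi> (Bcontfun (\<lambda>s. \<xi> (linf_L s f))))"

definition wap_corona ::
    "(('a::{group_add,discrete_topology}) linf \<Rightarrow> complex) set" where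
  "wap_corona = wap_space - range wap_point"

definition wap_corona_sq ::
    "(('a::{group_add,discrete_topology}) linf \<Rightarrow> complex) set" where
  "wap_corona_sq = {wap_mult y z | y z. y \<in> wap_corona \<and> z \<in> wap_corona}"

definition wap_cls ::
    "'a set \<Rightarrow> (('a::{group_add,discrete_topology}) linf \<Rightarrow> complex) set" where
  "wap_cls A = wap_topology closure_of (wap_point ` A)"

definition I_W :: "('a::{group_add,discrete_topology}) set set" where
  "I_W = {A. openin wap_topology (wap_cls A) \<and>
             wap_cls A \<inter> (wap_topology closure_of wap_corona_sq) = {}}"

definition I_IW :: "('a::{group_add,discrete_topology}) set set" where
  "I_IW = {A. openin wap_topology (wap_cls A) \<and>
              subtopology wap_topology (wap_cls A) homeomorphic_space beta_topology A}"

section \<open>The multiplication extends that of the group\<close>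

lemma topspace_linf_weak: "topspace (linf_weak :: ('a::discrete_topology) linf topology) = UNIV"
proof -
  have "(\<lambda>_. 0) \<in> (linf_dual :: ('a linf \<Rightarrow> complex) set)"
    by (simp add: linf_dual_def)
  then have "UNIV \<in> {\<phi> -` U | \<phi> U. \<phi> \<in> (linf_dual :: ('a linf \<Rightarrow> complex) set) \<and> open U}"
    using open_UNIV vimage_UNIV by blast
  then show ?thesis
    unfolding linf_weak_def topology_generated_by_topspace by (rule Union_upper[THEN top_le])
qed

lemma continuous_map_linf_weak_L:
  "continuous_map linf_weak linf_weak (linf_L (s::'a::{group_add,discrete_topology}))"
proof -
  have bl: "bounded_linear (linf_L s :: 'a linf \<Rightarrow> 'a linf)"
  proof (rule bounded_linear_intro[where K = 1])
    fix f g :: "'a linf" and r :: real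
    show "linf_L s (f + g) = linf_L s f + linf_L s g"
      by (rule bcontfun_eqI) (simp add: plus_bcontfun.rep_eq)
    show "linf_L s (r *\<^sub>R f) = r *\<^sub>R linf_L s f"
      by (rule bcontfun_eqI) simp
    show "norm (linf_L s f) \<le> norm f * 1"
      by (rule norm_bound) (simp add: norm_bounded)
  qed
  have dual: "\<phi> \<circ> linf_L s \<in> linf_dual" if "\<phi> \<in> linf_dual" for \<phi> :: "'a linf \<Rightarrow> complex"
  proof -
    have "linf_L s (linf_cscale c f) = linf_cscale c (linf_L s f)" for c and f :: "'a linf"
      by (rule bcontfun_eqI) (simp add: linf_cscale_def const_bcontfun.rep_eq)
    with that show ?thesis
      by (auto simp: linf_dual_def o_def intro: bounded_linear_compose[OF _ bl])
  qed
  have "openin linf_weak (linf_L s -` V)"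
    if "V \<in> {\<phi> -` U | \<phi> U. \<phi> \<in> linf_dual \<and> open U}" for V :: "'a linf set"
  proof -
    from that obtain \<phi> U where "\<phi> \<in> linf_dual" "open U" "V = \<phi> -` U" by auto
    then have "linf_L s -` V = (\<phi> \<circ> linf_L s) -` U" "\<phi> \<circ> linf_L s \<in> linf_dual"
      using dual by auto
    with \<open>open U\<close> show ?thesis
      unfolding linf_weak_def by (intro topology_generated_by_Basis) auto
  qed
  moreover have "\<Union> {\<phi> -` U | \<phi> U. \<phi> \<in> linf_dual \<and> open U} = (UNIV :: 'a linf set)"
    using topspace_linf_weak[where 'a = 'a]
    unfolding linf_weak_def topology_generated_by_topspace .
  ultimately show ?thesis
    by (subst (2) linf_weak_def, intro continuous_on_generated_topo)
      (simp_all only: topspace_linf_weak Int_UNIV_right subset_UNIV)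
qed

lemma linf_L_WAP:
  assumes "f \<in> WAP"
  shows "linf_L (s::'a::{group_add,discrete_topology}) f \<in> WAP"
proof -
  have inv: "linf_L t (linf_L (- t) g) = g" for t and g :: "'a linf"
    by (rule bcontfun_eqI) (simp add: add.assoc[symmetric])
  have "homeomorphic_maps linf_weak linf_weak (linf_L s) (linf_L (- s))"
    using inv[of "- s"] inv[of s]
    by (simp add: homeomorphic_maps_def continuous_map_linf_weak_L)
  then have hom: "homeomorphic_map linf_weak linf_weak (linf_L s)"
    by (auto simp: homeomorphic_map_maps)
  have "linf_weak closure_of range (\<lambda>t. linf_R t (linf_L s f)) =
      linf_L s ` (linf_weak closure_of range (\<lambda>t. linf_R t f))"
  proof -
    have "linf_R t (linf_L s f) = linf_L s (linf_R t f)" for t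
      by (rule bcontfun_eqI) (simp add: add.assoc)
    then have "range (\<lambda>t. linf_R t (linf_L s f)) = linf_L s ` range (\<lambda>t. linf_R t f)"
      by auto
    then show ?thesis
      using homeomorphic_map_closure_of[OF hom] by (simp add: topspace_linf_weak)
  qed
  then show ?thesis
    using assms image_compactin[OF _ continuous_map_linf_weak_L]
    by (auto simp: WAP_def)
qed

lemma wap_mult_point:
  fixes s t :: "'a::{group_add,discrete_topology}"
  shows "wap_mult (wap_point s) (wap_point t) = wap_point (s + t)"
proof
  fix f :: "'a linf"
  show "wap_mult (wap_point s) (wap_point t) f = wap_point (s + t) f"
  proof (cases "f \<in> WAP")
    case True
    have "wap_point t (linf_L u f) = f (u + t)" for u
      using linf_L_WAP[OF True, of u] by (simp add: wap_point_def)
    then have eq: "Bcontfun (\<lambda>u. wap_point t (linf_L u f)) = linf_R t f"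
      by (simp only: linf_R_def)
    have "range (\<lambda>u. linf_R u (linf_R t f)) = range (\<lambda>u. linf_R u f)"
    proof -
      have *: "linf_R u (linf_R t f) = linf_R (u + t) f" for u
        by (rule bcontfun_eqI) (simp add: add.assoc)
      have surj: "range (\<lambda>u. u + t) = UNIV"
        by (rule surjI[where f = "\<lambda>u. u - t"]) simp
      have "range (\<lambda>u. linf_R (u + t) f) = (\<lambda>u. linf_R u f) ` range (\<lambda>u. u + t)"
        unfolding image_image by (rule refl)
      then show ?thesis unfolding surj * .
    qed
    with True have "linf_R t f \<in> WAP" by (simp add: WAP_def)
    with True eq show ?thesis
      by (simp add: wap_mult_def wap_point_def)
  next
    case False
    then show ?thesis by (simp only: wap_mult_def wap_point_def restrict_def if_False)
  qed
qed

end

theory Submission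
  imports Defs
begin

text \<open>
  Ultrafilters are handled as filters. For ultrafilters \<open>P\<close>, \<open>Q\<close>, the filters
  \<open>iterf (+) P Q\<close> and \<open>iterf (\<lambda>t s. s + t) Q P\<close> are the two products on
  \<open>\<beta>\<Gamma>\<close>, and limits along them are iterated limits of \<open>f(st)\<close> in the two orders.

  A compactness argument on filters shows that \<open>A\<close> is LTF (RTF) iff it belongs to no product of
  the first (second) kind of nonprincipal ultrafilters; this gives (1) and (2).

  For (3), since \<open>\<Gamma>\<close> is countable, \<open>f\<close> is weakly almost periodic iff its limits along
  the two products agree. So \<open>WAP\<close> is a self-adjoint algebra, every point of
  \<open>\<Gamma>\<^sup>W\<^sup>A\<^sup>P\<close> is evaluation along an ultrafilter, and the product of two such points is evaluation
  along the product ultrafilter. If \<open>A\<close> is TF, the indicators of all its subsets are in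
  \<open>WAP\<close>, which yields \<open>I_W\<close> and \<open>I_IW\<close>. Conversely, if all subsets of
  \<open>A\<close> have open closure, each of them belongs to both products or to neither; were \<open>A\<close> not TF,
  it would contain products \<open>c\<^sub>n d\<^sub>k\<close>, \<open>n \<le> k\<close>, all distinct from those with
  \<open>n > k\<close>, and the set of the former would be in one product only.
\<close>

section \<open>Ultrafilters\<close>

definition ultra :: "'a filter \<Rightarrow> bool" where
  "ultra F \<longleftrightarrow> F \<noteq> bot \<and> (\<forall>P. eventually P F \<or> eventually (\<lambda>x. \<not> P x) F)"

lemma ultra_not_bot: "ultra F \<Longrightarrow> F \<noteq> bot"
  by (simp add: ultra_def)

lemma ultra_not:
  assumes "ultra F"
  shows "eventually (\<lambda>x. \<not> P x) F \<longleftrightarrow> \<not> eventually P F"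
proof
  assume "eventually (\<lambda>x. \<not> P x) F"
  then have "eventually (\<lambda>x. False) F" if "eventually P F"
    using that by eventually_elim simp
  then show "\<not> eventually P F" using assms by (auto simp: ultra_def)
qed (use assms in \<open>auto simp: ultra_def\<close>)

lemma ultra_Bex:
  assumes "ultra F" "finite I"
  shows "eventually (\<lambda>x. \<exists>i\<in>I. P i x) F \<longleftrightarrow> (\<exists>i\<in>I. eventually (P i) F)"
proof -
  have "\<not> eventually (\<lambda>x. \<exists>i\<in>I. P i x) F \<longleftrightarrow> eventually (\<lambda>x. \<forall>i\<in>I. \<not> P i x) F"
    using ultra_not[OF assms(1), of "\<lambda>x. \<exists>i\<in>I. P i x"] by simp
  also have "\<dots> \<longleftrightarrow> (\<forall>i\<in>I. \<not> eventually (P i) F)"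
    by (simp add: eventually_ball_finite_distrib assms ultra_not)
  finally show ?thesis by blast
qed

text \<open>Zorn's lemma for the proper filters below \<open>F\<close> in reversed order, so that
  the element found is a minimal proper filter. If \<open>P\<close> is not eventually false in it,
  cutting it down to \<open>P\<close> leaves it proper, hence unchanged by minimality.\<close>

lemma ex_ultra_le:
  fixes F :: "'a filter"
  assumes "F \<noteq> bot"
  shows "\<exists>U. ultra U \<and> U \<le> F"
proof -
  let ?A = "{G. G \<le> F \<and> G \<noteq> bot}"
  have "\<exists>m\<in>?A. \<forall>a\<in>?A. a \<le> m \<longrightarrow> a = m"
  proof (rule predicate_Zorn)
    show "partial_order_on ?A (relation_of (\<lambda>x y. y \<le> x) ?A)"
      by (rule partial_order_on_relation_ofI) auto
    fix C assume C: "C \<in> Chains (relation_of (\<lambda>x y. y \<le> x) ?A)"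
    have sub: "C \<subseteq> ?A" and lin: "\<And>a b. a \<in> C \<Longrightarrow> b \<in> C \<Longrightarrow> a \<le> b \<or> b \<le> a"
      using C unfolding Chains_def relation_of_def by blast+
    show "\<exists>u\<in>?A. \<forall>a\<in>C. u \<le> a"
    proof (cases "C = {}")
      case True
      with assms show ?thesis by auto
    next
      case False
      \<comment> \<open>By linearity, whatever holds eventually in the infimum of a chain already
        does so in one member; hence the infimum is proper.\<close>
      have base: "\<exists>x\<in>C. x \<le> inf a b" if "a \<in> C" "b \<in> C" for a b
        using lin[OF that] that by auto
      have "\<not> eventually (\<lambda>_. False) (Inf C)"
        using sub by (subst eventually_Inf_base[OF False base]) (auto simp: trivial_limit_def)
      then have "Inf C \<noteq> bot" by (auto simp: trivial_limit_def)
      moreover have "Inf C \<le> F" using False sub by (auto intro: Inf_lower2)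
      ultimately show ?thesis by (intro bexI[of _ "Inf C"]) (auto intro: Inf_lower)
    qed
  qed
  then obtain m where m: "m \<le> F" "m \<noteq> bot" "\<And>a. a \<le> F \<Longrightarrow> a \<noteq> bot \<Longrightarrow> a \<le> m \<Longrightarrow> a = m"
    by auto
  have "eventually P m" if "\<not> eventually (\<lambda>x. \<not> P x) m" for P
  proof -
    have "inf m (principal {x. P x}) \<noteq> bot"
      using that by (auto simp: trivial_limit_def eventually_inf_principal elim: eventually_mono)
    moreover have "inf m (principal {x. P x}) \<le> F" using m(1) by (rule le_infI1)
    ultimately have "inf m (principal {x. P x}) = m" by (intro m(3)) auto
    then have "m \<le> principal {x. P x}" by (metis inf.cobounded2)
    then show ?thesis by (auto simp: le_principal)
  qed
  then show ?thesis using m by (intro exI[of _ m]) (auto simp: ultra_def)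
qed

lemma ultra_principal: "ultra (principal {x})"
  by (auto simp: ultra_def eventually_principal principal_eq_bot_iff)

lemma not_principal_le_cofinite: "\<not> principal {x} \<le> cofinite"
  by (auto simp: le_filter_def eventually_cofinite eventually_principal intro!: exI[of _ "\<lambda>y. y \<noteq> x"])

lemma ultra_filtermap: "ultra F \<Longrightarrow> ultra (filtermap f F)"
  by (auto simp: ultra_def eventually_filtermap filtermap_bot_iff)

lemma ultra_eq_principal_iff:
  assumes "ultra F"
  shows "F = principal {y} \<longleftrightarrow> (\<forall>\<^sub>F x in F. x = y)"
proof
  assume y: "\<forall>\<^sub>F x in F. x = y"
  have "eventually P F \<longleftrightarrow> P y" for P
  proof
    assume "P y" then show "eventually P F" using y by (auto elim: eventually_mono)
  next
    assume "eventually P F"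
    with y have "\<forall>\<^sub>F x in F. P y" by eventually_elim auto
    then show "P y" using assms by (auto simp: ultra_def eventually_const_iff)
  qed
  then show "F = principal {y}" by (simp add: filter_eq_iff eventually_principal)
qed (simp add: eventually_principal)

lemma ultra_eq_principal:
  assumes "ultra F" "\<not> F \<le> cofinite"
  shows "\<exists>x. F = principal {x}"
proof -
  obtain S where S: "finite S" "\<not> eventually (\<lambda>x. x \<notin> S) F"
  proof -
    from assms(2) obtain P where "eventually P cofinite" "\<not> eventually P F"
      by (auto simp: le_filter_def)
    then show ?thesis using that[of "{x. \<not> P x}"] by (auto simp: eventually_cofinite)
  qed
  then have "eventually (\<lambda>x. \<exists>y\<in>S. x = y) F"
    using ultra_not[OF assms(1), of "\<lambda>x. x \<in> S"] by simp
  then obtain y where y: "eventually (\<lambda>x. x = y) F"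
    using ultra_Bex[OF assms(1) S(1), of "\<lambda>y x. x = y"] by auto
  with ultra_eq_principal_iff[OF assms(1)] show ?thesis by blast
qed

lemma free_ultra_exists:
  assumes "infinite S"
  shows "\<exists>F. ultra F \<and> F \<le> cofinite \<and> eventually (\<lambda>x. x \<in> S) F"
proof -
  have "inf cofinite (principal S) \<noteq> bot"
    using assms by (auto simp: trivial_limit_def eventually_inf_principal eventually_cofinite)
  from ex_ultra_le[OF this] show ?thesis by (auto simp: le_principal)
qed

lemma free_ultra_infinite:
  assumes "F \<le> cofinite" "F \<noteq> bot" "eventually (\<lambda>x. x \<in> S) F"
  shows "infinite S"
proof
  assume "finite S"
  then have "eventually (\<lambda>x. x \<notin> S) F"
    using assms(1) by (auto simp: le_filter_def eventually_cofinite)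
  with assms(3) have "eventually (\<lambda>x. False) F" by eventually_elim simp
  with assms(2) show False by simp
qed

section \<open>Limits along ultrafilters and iterated limits\<close>

lemma ultra_tendsto:
  fixes f :: "'a \<Rightarrow> 'b::heine_borel"
  assumes "ultra F" "bounded (range f)"
  shows "(f \<longlongrightarrow> Lim F f) F"
proof -
  have "compact (closure (range f))" using assms(2) by (simp add: compact_closure)
  moreover have "filtermap f F \<noteq> bot" using assms(1) by (simp add: ultra_def filtermap_bot_iff)
  moreover have "eventually (\<lambda>y. y \<in> closure (range f)) (filtermap f F)"
    by (auto simp: eventually_filtermap intro!: always_eventually subsetD[OF closure_subset])
  ultimately obtain l where l: "inf (nhds l) (filtermap f F) \<noteq> bot"
    unfolding compact_filter by blast
  \<comment> \<open>An ultrafilter converges to each of its cluster points: if a neighbourhood of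
    \<open>l\<close> were not in it, the complement would be, and \<open>l\<close> would not be a
    cluster point.\<close>
  have "(f \<longlongrightarrow> l) F"
  proof (rule topological_tendstoI, rule ccontr)
    fix V assume V: "open V" "l \<in> V" "\<not> (\<forall>\<^sub>F x in F. f x \<in> V)"
    then have "\<forall>\<^sub>F y in filtermap f F. y \<notin> V"
      using ultra_not[OF assms(1)] by (simp add: eventually_filtermap)
    moreover have "\<forall>\<^sub>F y in nhds l. y \<in> V" using V by (auto simp: eventually_nhds)
    ultimately have "\<forall>\<^sub>F y in inf (nhds l) (filtermap f F). False"
      unfolding eventually_inf by (intro exI conjI) auto
    with l show False by simp
  qed
  then show ?thesis using tendsto_Lim[OF ultra_not_bot[OF assms(1)]] by metis
qed

lemma ultra_Lim_eq: "ultra F \<Longrightarrow> (f \<longlongrightarrow> l) F \<Longrightarrow> Lim F f = (l::'b::t2_space)"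
  by (simp add: tendsto_Lim ultra_def)

lemma Lim_principal: "Lim (principal {x}) f = (f x :: 'b::t2_space)"
  by (rule ultra_Lim_eq[OF ultra_principal]) (auto intro!: tendsto_eventually simp: eventually_principal)

lemma norm_Lim_le:
  fixes f :: "'a \<Rightarrow> complex"
  assumes "ultra F" "\<And>x. norm (f x) \<le> c"
  shows "norm (Lim F f) \<le> c"
proof -
  have "bounded (range f)" using assms(2) by (auto simp: bounded_iff)
  from tendsto_norm[OF ultra_tendsto[OF assms(1) this]] show ?thesis
    using assms(2) by (intro tendsto_upperbound[OF _ _ ultra_not_bot[OF assms(1)]]) auto
qed

text \<open>The image under \<open>m\<close> of the Fubini product of \<open>P\<close> and
  \<open>Q\<close>. With \<open>m\<close> arbitrary, each fact about it covers both products and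
  both sides of translation.\<close>

definition iterf :: "('a \<Rightarrow> 'b \<Rightarrow> 'c) \<Rightarrow> 'a filter \<Rightarrow> 'b filter \<Rightarrow> 'c filter" where
  "iterf m P Q = Abs_filter (\<lambda>R. \<forall>\<^sub>F x in P. \<forall>\<^sub>F y in Q. R (m x y))"

lemma eventually_iterf:
  "eventually R (iterf m P Q) \<longleftrightarrow> (\<forall>\<^sub>F x in P. \<forall>\<^sub>F y in Q. R (m x y))"
  unfolding iterf_def
proof (rule eventually_Abs_filter, rule is_filter.intro, goal_cases)
  case (2 R S)
  then show ?case by eventually_elim (rule eventually_conj)
next
  case (3 R S)
  from 3(2) show ?case by eventually_elim (use 3(1) in \<open>auto elim: eventually_mono\<close>)
qed simp

lemma ultra_iterf:
  assumes "ultra P" "ultra Q"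
  shows "ultra (iterf m P Q)"
  unfolding ultra_def[of "iterf m P Q"] trivial_limit_def eventually_iterf
  using assms by (simp add: ultra_not ultra_not_bot eventually_const_iff)

text \<open>Boundedness makes all the inner limits exist. The tolerance is halved because the inner
  limit preserves only the nonstrict inequality.\<close>

lemma Lim_iterf:
  fixes f :: "'c \<Rightarrow> complex"
  assumes "ultra P" "ultra Q" "bounded (range f)"
  shows "Lim (iterf m P Q) f = Lim P (\<lambda>x. Lim Q (\<lambda>y. f (m x y)))"
proof -
  obtain c where c: "\<And>x. norm (f x) \<le> c" using assms(3) by (auto simp: bounded_iff)
  let ?l = "Lim (iterf m P Q) f"
  have t: "(f \<longlongrightarrow> ?l) (iterf m P Q)" by (intro ultra_tendsto ultra_iterf assms)
  have "((\<lambda>x. Lim Q (\<lambda>y. f (m x y))) \<longlongrightarrow> ?l) P"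
  proof (rule tendstoI)
    fix e :: real assume "e > 0"
    then have "\<forall>\<^sub>F x in P. \<forall>\<^sub>F y in Q. dist (f (m x y)) ?l < e / 2"
      using tendstoD[OF t, of "e/2"] by (simp add: eventually_iterf)
    then show "\<forall>\<^sub>F x in P. dist (Lim Q (\<lambda>y. f (m x y))) ?l < e"
    proof eventually_elim
      case (elim x)
      have "((\<lambda>y. f (m x y)) \<longlongrightarrow> Lim Q (\<lambda>y. f (m x y))) Q"
        using c by (intro ultra_tendsto assms) (auto simp: bounded_iff)
      then have "dist (Lim Q (\<lambda>y. f (m x y))) ?l \<le> e / 2"
        using elim ultra_not_bot[OF assms(2)]
        by (intro tendsto_upperbound[OF tendsto_dist[OF _ tendsto_const]])
          (auto elim: eventually_mono)
      with \<open>e > 0\<close> show ?case by simp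
    qed
  qed
  then show ?thesis using ultra_Lim_eq[OF assms(1)] by metis
qed

lemma Lim_indicator:
  assumes "ultra F"
  shows "Lim F (\<lambda>x. if x \<in> A then 1 else 0 :: complex) = (if eventually (\<lambda>x. x \<in> A) F then 1 else 0)"
proof (cases "eventually (\<lambda>x. x \<in> A) F")
  case True
  then show ?thesis
    by (auto intro!: ultra_Lim_eq[OF assms] tendsto_eventually elim: eventually_mono)
next
  case False
  then have "eventually (\<lambda>x. x \<notin> A) F" using ultra_not[OF assms] by blast
  with False show ?thesis
    by (auto intro!: ultra_Lim_eq[OF assms] tendsto_eventually elim: eventually_mono)
qed

section \<open>Translation-finiteness and ultrafilters\<close>

text \<open>The common form of \<open>LTF\<close> and \<open>RTF\<close>: the first is the case
  \<open>m = (+)\<close>, the second the case of the flipped sum, and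
  \<open>{y. m x y \<in> A}\<close> is the translate of \<open>A\<close> by
  \<open>x\<close>.\<close>

definition translation_finite :: "('a \<Rightarrow> 'b \<Rightarrow> 'c) \<Rightarrow> 'c set \<Rightarrow> bool" where
  "translation_finite m A \<longleftrightarrow> (\<forall>D. infinite D \<longrightarrow>
     (\<exists>F. finite F \<and> F \<subseteq> D \<and> finite {y. \<forall>x\<in>F. m x y \<in> A}))"

text \<open>If a free product contains \<open>A\<close>, the \<open>x\<close> whose translates lie
  in \<open>Q\<close> form an infinite set \<open>D\<close>, and finite intersections of these
  translates lie in \<open>Q\<close>, so they are infinite. Conversely, an infinite \<open>D\<close>
  violating the condition yields a free \<open>Q\<close> containing all its translates, and any free
  \<open>P\<close> containing \<open>D\<close> then gives a product containing
  \<open>A\<close>.\<close>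

lemma translation_finite_iff:
  "translation_finite m A \<longleftrightarrow>
     (\<forall>P Q. ultra P \<longrightarrow> P \<le> cofinite \<longrightarrow> ultra Q \<longrightarrow> Q \<le> cofinite \<longrightarrow>
       \<not> eventually (\<lambda>z. z \<in> A) (iterf m P Q))"
proof (intro iffI allI impI notI)
  fix P :: "'a filter" and Q :: "'b filter"
  assume tf: "translation_finite m A" and PQ: "ultra P" "P \<le> cofinite" "ultra Q" "Q \<le> cofinite"
    and ev: "\<forall>\<^sub>F z in iterf m P Q. z \<in> A"
  define D where "D = {x. \<forall>\<^sub>F y in Q. m x y \<in> A}"
  have "\<forall>\<^sub>F x in P. x \<in> D" using ev by (simp add: D_def eventually_iterf)
  then have "infinite D" using PQ free_ultra_infinite ultra_not_bot by blast
  then obtain F where F: "finite F" "F \<subseteq> D" "finite {y. \<forall>x\<in>F. m x y \<in> A}"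
    using tf by (auto simp: translation_finite_def)
  have "\<forall>\<^sub>F y in Q. y \<in> {y. \<forall>x\<in>F. m x y \<in> A}"
    using F by (auto simp: D_def intro!: eventually_ball_finite)
  then show False using F(3) PQ free_ultra_infinite ultra_not_bot by blast
next
  assume *: "\<forall>P Q. ultra P \<longrightarrow> P \<le> cofinite \<longrightarrow> ultra Q \<longrightarrow> Q \<le> cofinite \<longrightarrow>
       \<not> eventually (\<lambda>z. z \<in> A) (iterf m P Q)"
  show "translation_finite m A"
  proof (rule ccontr)
    assume "\<not> translation_finite m A"
    then obtain D where D: "infinite D"
      and inf: "\<And>F. finite F \<Longrightarrow> F \<subseteq> D \<Longrightarrow> infinite {y. \<forall>x\<in>F. m x y \<in> A}"
      by (auto simp: translation_finite_def)
    \<comment> \<open>Generated by the cofinite sets and the translates over \<open>D\<close>; it is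
      proper because finite intersections of these translates are infinite.\<close>
    define G where "G = inf cofinite (INF x\<in>D. principal {y. m x y \<in> A})"
    have "G \<noteq> bot"
    proof
      assume "G = bot"
      then have "eventually (\<lambda>_. False) G" by simp
      then obtain R S where R: "eventually R cofinite"
        and S: "eventually S (INF x\<in>D. principal {y. m x y \<in> A})" and RS: "\<And>y. \<not> (R y \<and> S y)"
        unfolding G_def eventually_inf by auto
      from S obtain F where F: "F \<subseteq> D" "finite F"
        "eventually S (INF x\<in>F. principal {y. m x y \<in> A})"
        unfolding eventually_INF[of _ _ D] by auto
      then have "{y. \<forall>x\<in>F. m x y \<in> A} \<subseteq> {y. \<not> R y}"
        using RS by (auto simp: INF_principal_finite eventually_principal)
      moreover have "finite {y. \<not> R y}" using R by (simp add: eventually_cofinite)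
      ultimately show False using inf[OF F(2,1)] finite_subset by blast
    qed
    then obtain Q where Q: "ultra Q" "Q \<le> G" using ex_ultra_le by blast
    obtain P where P: "ultra P" "P \<le> cofinite" "eventually (\<lambda>x. x \<in> D) P"
      using free_ultra_exists[OF D] by blast
    have "\<forall>\<^sub>F y in Q. m x y \<in> A" if "x \<in> D" for x
    proof -
      have "Q \<le> principal {y. m x y \<in> A}"
        using Q(2) that by (auto simp: G_def intro: order.trans INF_lower)
      then show ?thesis by (simp add: le_principal)
    qed
    with P(3) have "eventually (\<lambda>z. z \<in> A) (iterf m P Q)"
      by (auto simp: eventually_iterf elim: eventually_mono)
    with * P Q show False by (auto simp: G_def)
  qed
qed

text \<open>
  The pairs are chosen one stage at a time, each new product avoiding the finitely many products
  of the other kind that are already present.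
\<close>

lemma triangular_sequences:
  fixes m :: "'a \<Rightarrow> 'b \<Rightarrow> 'c"
  assumes inj: "\<And>x. inj (m x)" "\<And>y. inj (\<lambda>x. m x y)"
    and D: "infinite D"
    and inf: "\<And>F. finite F \<Longrightarrow> F \<subseteq> D \<Longrightarrow> infinite {y. \<forall>x\<in>F. m x y \<in> A}"
  obtains c :: "nat \<Rightarrow> 'a" and d :: "nat \<Rightarrow> 'b" where
    "\<And>n k. n \<le> k \<Longrightarrow> m (c n) (d k) \<in> A"
    "\<And>n k i j. n \<le> k \<Longrightarrow> j < i \<Longrightarrow> m (c n) (d k) \<noteq> m (c i) (d j)"
proof -
  \<comment> \<open>Call a product \<open>m (c n) (d k)\<close> upper if \<open>n \<le> k\<close>
    and lower otherwise. The last two clauses separate the new lower products of stage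
    \<open>n\<close> from the old upper ones, and then the new upper products from all lower
    ones.\<close>
  define V where "V n h \<longleftrightarrow> fst (h n) \<in> D \<and> (\<forall>k\<le>n. m (fst (h k)) (snd (h n)) \<in> A) \<and>
    (\<forall>j<n. \<forall>l<n. \<forall>k\<le>l. m (fst (h n)) (snd (h j)) \<noteq> m (fst (h k)) (snd (h l))) \<and>
    (\<forall>i\<le>n. \<forall>j<i. \<forall>k\<le>n. m (fst (h k)) (snd (h n)) \<noteq> m (fst (h i)) (snd (h j)))"
    for n :: nat and h :: "nat \<Rightarrow> 'a \<times> 'b"
  \<comment> \<open>\<open>V n\<close> reads \<open>h\<close> only up to index \<open>n\<close>, as
    the recursion along \<open>less_than\<close> requires.\<close>
  have V_cong: "V n g" if "V n h" "\<And>k. k \<le> n \<Longrightarrow> g k = h k" for n g h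
    using that(1) unfolding V_def by (simp add: that(2))
  have "\<exists>f. \<forall>n. V n (f(n := f n))"
  proof (rule dependent_wf_choice[of less_than "\<lambda>f n r. V n (f(n := r))"])
    fix n and f :: "nat \<Rightarrow> 'a \<times> 'b"
    assume V: "V k (f(k := f k))" if "(k, n) \<in> less_than" for k
    \<comment> \<open>The choices of \<open>x\<close> that would create a lower product equal to an
      old upper one. There are finitely many, as \<open>m\<close> is injective in its first
      argument.\<close>
    define bad where "bad = (\<Union>j<n. \<Union>l<n. \<Union>k\<le>l. (\<lambda>x. m x (snd (f j))) -` {m (fst (f k)) (snd (f l))})"
    have "finite bad" unfolding bad_def using inj(2) by (intro finite_UN_I finite_vimageI) auto
    then have "infinite (D - bad)" using D by simp
    then obtain x where x: "x \<in> D" "x \<notin> bad" using infinite_imp_nonempty by blast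
    \<comment> \<open>With \<open>x\<close> fixed, \<open>C\<close> lists the first components up to
      \<open>n\<close>. The set \<open>bad'\<close> then excludes each \<open>y\<close> giving an
      upper product equal to a lower one, those formed with \<open>x\<close> included.\<close>
    define C where "C i = (if i = n then x else fst (f i))" for i
    define bad' where "bad' = (\<Union>i\<le>n. \<Union>j<i. \<Union>k\<le>n. m (C k) -` {m (C i) (snd (f j))})"
    have "finite bad'" unfolding bad'_def using inj(1) by (intro finite_UN_I finite_vimageI) auto
    moreover have "C ` {..n} \<subseteq> D" using x V by (auto simp: C_def V_def)
    ultimately have "infinite ({y. \<forall>x\<in>C ` {..n}. m x y \<in> A} - bad')"
      using inf[of "C ` {..n}"] by (simp del: image_subset_iff ball_simps)
    then obtain y where y: "\<forall>x\<in>C ` {..n}. m x y \<in> A" "y \<notin> bad'"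
      using infinite_imp_nonempty by blast
    have C: "fst ((f(n := (x, y))) i) = C i" for i by (simp add: C_def)
    have Cn: "C n = x" "\<And>i. i < n \<Longrightarrow> fst (f i) = C i" by (auto simp: C_def)
    have "V n (f(n := (x, y)))"
      unfolding V_def C using x y by (auto simp: Cn bad_def bad'_def)
    then show "\<exists>r. V n (f(n := r))" by blast
  qed (auto elim!: V_cong)
  then obtain f where V: "\<And>n. V n f" by auto
  show thesis
  proof (rule that[of "\<lambda>n. fst (f n)" "\<lambda>n. snd (f n)"])
    show "m (fst (f n)) (snd (f k)) \<in> A" if "n \<le> k" for n k
      using V[of k] that by (auto simp: V_def)
    show "m (fst (f n)) (snd (f k)) \<noteq> m (fst (f i)) (snd (f j))" if "n \<le> k" "j < i" for n k i j
    \<comment> \<open>The inequality was imposed at the later of the two stages \<open>i\<close> and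
      \<open>k\<close>.\<close>
    proof (cases "k < i")
      case True
      then show ?thesis using V[of i] that unfolding V_def by metis
    next
      case False
      then have "i \<le> k" by simp
      then show ?thesis using V[of k] that unfolding V_def by metis
    qed
  qed
qed

text \<open>Let \<open>B\<close> be the set of upper products from
  \<open>triangular_sequences\<close>, and push one free ultrafilter on the naturals forward along
  \<open>c\<close> and \<open>d\<close>. For fixed \<open>n\<close> almost all \<open>k\<close>
  exceed \<open>n\<close>, so one product contains \<open>B\<close>; for fixed \<open>k\<close>
  almost all \<open>n\<close> exceed \<open>k\<close>, so the other does not. As \<open>B\<close> is
  only a part of \<open>A\<close>, \<open>comm\<close> speaks of all subsets.\<close>

lemma translation_finite_if_commute:
  fixes m :: "'a \<Rightarrow> 'b \<Rightarrow> 'c"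
  assumes inj: "\<And>x. inj (m x)" "\<And>y. inj (\<lambda>x. m x y)"
    and comm: "\<And>B P Q. B \<subseteq> A \<Longrightarrow> ultra P \<Longrightarrow> ultra Q \<Longrightarrow>
      eventually (\<lambda>z. z \<in> B) (iterf m P Q) \<longleftrightarrow> eventually (\<lambda>z. z \<in> B) (iterf (\<lambda>y x. m x y) Q P)"
  shows "translation_finite m A"
proof (rule ccontr)
  assume "\<not> translation_finite m A"
  then obtain D where D: "infinite D"
    "\<And>F. finite F \<Longrightarrow> F \<subseteq> D \<Longrightarrow> infinite {y. \<forall>x\<in>F. m x y \<in> A}"
    by (auto simp: translation_finite_def)
  obtain c d where A: "\<And>n k. n \<le> k \<Longrightarrow> m (c n) (d k) \<in> A"
    and ne: "\<And>n k i j. n \<le> (k::nat) \<Longrightarrow> j < (i::nat) \<Longrightarrow> m (c n) (d k) \<noteq> m (c i) (d j)"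
    using triangular_sequences[of m, OF inj D] by metis
  define B where "B = {m (c n) (d k) | n k. n \<le> k}"
  have sub: "B \<subseteq> A" using A by (auto simp: B_def)
  obtain U :: "nat filter" where U: "ultra U" "U \<le> sequentially"
    using ex_ultra_le[of "sequentially"] by auto
  have ev: "\<forall>\<^sub>F n in U. k < n" for k
    using U(2) by (rule filter_leD) (rule eventually_gt_at_top)
  have 1: "\<forall>\<^sub>F z in iterf m (filtermap c U) (filtermap d U). z \<in> B"
    unfolding eventually_iterf eventually_filtermap
  proof (rule always_eventually, rule allI)
    show "\<forall>\<^sub>F k in U. m (c n) (d k) \<in> B" for n
      using ev[of n] by eventually_elim (auto simp: B_def intro: less_imp_le)
  qed
  have 2: "\<not> (\<forall>\<^sub>F z in iterf (\<lambda>y x. m x y) (filtermap d U) (filtermap c U). z \<in> B)"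
    unfolding eventually_iterf eventually_filtermap ultra_not[OF U(1), symmetric]
  proof (rule always_eventually, rule allI)
    show "\<forall>\<^sub>F n in U. m (c n) (d k) \<notin> B" for k
      using ev[of k] by eventually_elim (use ne in \<open>force simp: B_def\<close>)
  qed
  show False using comm[OF sub, of "filtermap c U" "filtermap d U"] 1 2 U(1) by (simp add: ultra_filtermap)
qed

section \<open>Weak convergence of bounded sequences\<close>

text \<open>
  The unions \<open>A N \<union> \<dots> \<union> A (M N)\<close> can be chosen to exhaust \<open>\<Union>n\<ge>N. A n\<close> up to
  measure \<open>e / 2^(N+2)\<close>; all these unions then have the finite intersection property.
\<close>

lemma ultra_in_infinitely_many:
  fixes \<mu> :: "'a set \<Rightarrow> real" and A :: "nat \<Rightarrow> 'a set"
  assumes nonneg: "\<And>S. 0 \<le> \<mu> S" and add: "\<And>S T. S \<inter> T = {} \<Longrightarrow> \<mu> (S \<union> T) = \<mu> S + \<mu> T"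
    and e: "e > 0" "\<And>n. e \<le> \<mu> (A n)"
  shows "\<exists>P. ultra P \<and> infinite {n. eventually (\<lambda>x. x \<in> A n) P}"
proof -
  have diff: "\<mu> (T - S) = \<mu> T - \<mu> S" if "S \<subseteq> T" for S T
    using add[of S "T - S"] that by (simp add: Un_absorb1)
  have mono: "\<mu> S \<le> \<mu> T" if "S \<subseteq> T" for S T
    using diff[OF that] nonneg[of "T - S"] by simp
  have subadd: "\<mu> (\<Union>i\<in>I. T i) \<le> (\<Sum>i\<in>I. \<mu> (T i))" if "finite I" for I :: "nat set" and T
    using that
  proof (induction I rule: finite_induct)
    case empty
    show ?case using add[of "{}" "{}"] by simp
  next
    case (insert i I)
    have "\<mu> (\<Union>i\<in>insert i I. T i) = \<mu> (T i) + \<mu> ((\<Union>i\<in>I. T i) - T i)"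
      using add[of "T i" "(\<Union>i\<in>I. T i) - T i"] by simp
    also have "\<dots> \<le> \<mu> (T i) + (\<Sum>i\<in>I. \<mu> (T i))"
      using mono[of "(\<Union>i\<in>I. T i) - T i" "\<Union>i\<in>I. T i"] insert.IH by auto
    finally show ?case using insert.hyps by simp
  qed
  define B where "B N K = (\<Union>n\<in>{N..K}. A n)" for N K :: nat
  have "\<exists>M. \<forall>K. \<mu> (B N K) \<le> \<mu> (B N M) + e / 2 ^ (N + 2)" for N
  proof -
    have bdd: "bdd_above (range (\<lambda>K. \<mu> (B N K)))"
      using mono[OF subset_UNIV] by (auto simp: bdd_above_def)
    have "(SUP K. \<mu> (B N K)) - e / 2 ^ (N + 2) < (SUP K. \<mu> (B N K))" using e by simp
    then obtain M where "(SUP K. \<mu> (B N K)) - e / 2 ^ (N + 2) < \<mu> (B N M)"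
      using less_cSUP_iff[OF _ bdd] by auto
    then have "\<mu> (B N K) \<le> \<mu> (B N M) + e / 2 ^ (N + 2)" for K
      using cSUP_upper[OF _ bdd, of K] by (simp add: algebra_simps)
    then show ?thesis by blast
  qed
  then obtain M where M: "\<And>N K. \<mu> (B N K) \<le> \<mu> (B N (M N)) + e / 2 ^ (N + 2)" by metis
  define C where "C k = (\<Inter>N\<le>k. B N (M N))" for k
  have C_ne: "C k \<noteq> {}" for k
  proof
    assume "C k = {}"
    \<comment> \<open>If \<open>C k\<close> is empty, every point of \<open>A k\<close> is missed by
      some \<open>B N (M N)\<close> with \<open>N \<le> k\<close>; the missed parts have total
      measure below \<open>e / 2\<close>.\<close>
    then have "A k = (\<Union>N\<in>{..k}. A k - B N (M N))" unfolding C_def by blast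
    then have "\<mu> (A k) \<le> (\<Sum>N\<le>k. \<mu> (A k - B N (M N)))"
      using subadd[of "{..k}" "\<lambda>N. A k - B N (M N)"] by simp
    also have "\<dots> \<le> (\<Sum>N\<le>k. e / 2 ^ (N + 2))"
    proof (rule sum_mono)
      fix N assume "N \<in> {..k}"
      \<comment> \<open>The upper index \<open>max k (M N)\<close> makes the larger union contain
        both \<open>A k\<close> and \<open>B N (M N)\<close>.\<close>
      then have "\<mu> (A k - B N (M N)) \<le> \<mu> (B N (max k (M N)) - B N (M N))"
        by (intro mono) (auto simp: B_def)
      also have "\<dots> = \<mu> (B N (max k (M N))) - \<mu> (B N (M N))"
        unfolding B_def by (intro diff UN_mono) auto
      finally show "\<mu> (A k - B N (M N)) \<le> e / 2 ^ (N + 2)" using M[of N "max k (M N)"] by simp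
    qed
    also have "\<dots> = e / 2 - e / 2 ^ (k + 2)"
      by (induction k) (simp_all add: field_simps)
    also have "\<dots> < e" using e(1) by (smt (verit) divide_pos_pos field_sum_of_halves zero_less_power)
    finally show False using e(2)[of k] by simp
  qed
  have anti: "C l \<subseteq> C k" if "k \<le> l" for k l using that by (force simp: C_def)
  have ev: "eventually R (INF k. principal (C k)) \<longleftrightarrow> (\<exists>k. \<forall>x\<in>C k. R x)" for R
  proof -
    have "eventually R (INF k. principal (C k)) \<longleftrightarrow> (\<exists>k\<in>UNIV. eventually R (principal (C k)))"
    proof (rule eventually_INF_base)
      show "\<exists>x\<in>UNIV. principal (C x) \<le> inf (principal (C a)) (principal (C b))" for a b
        by (intro bexI[of _ "max a b"]) (use anti[of a "max a b"] anti[of b "max a b"] in auto)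
    qed simp
    then show ?thesis by (simp add: eventually_principal)
  qed
  have "(INF k. principal (C k)) \<noteq> bot"
    using C_ne unfolding trivial_limit_def ev by blast
  then obtain P where P: "ultra P" "P \<le> (INF k. principal (C k))" using ex_ultra_le by blast
  \<comment> \<open>\<open>P\<close> contains the finite union over \<open>{N..M N}\<close>, hence
    one of its members; varying \<open>N\<close> gives infinitely many indices.\<close>
  have "\<exists>n\<ge>N. eventually (\<lambda>x. x \<in> A n) P" for N
  proof -
    have "eventually (\<lambda>x. \<exists>n\<in>{N..M N}. x \<in> A n) (INF k. principal (C k))"
      unfolding ev by (rule exI[of _ N]) (auto simp: C_def B_def)
    then have "eventually (\<lambda>x. \<exists>n\<in>{N..M N}. x \<in> A n) P" using P(2) by (rule filter_leD[rotated])
    then show ?thesis using ultra_Bex[OF P(1), of "{N..M N}"] by auto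
  qed
  then show ?thesis using P(1) by (auto simp: infinite_nat_iff_unbounded_le)
qed

section \<open>Functionals on bounded functions and their variation\<close>

definition linf_ind :: "'a::discrete_topology set \<Rightarrow> 'a linf" where
  "linf_ind S = Bcontfun (\<lambda>x. if x \<in> S then 1 else 0)"

lemma apply_linf_ind [simp]: "apply_bcontfun (linf_ind S) x = (if x \<in> S then 1 else 0)"
proof -
  have "(\<lambda>x. if x \<in> S then 1 else 0 :: complex) \<in> bcontfun"
    by (auto simp: bcontfun_discrete_iff bounded_iff intro!: exI[of _ 1])
  then show ?thesis by (simp add: linf_ind_def Bcontfun_inverse)
qed

lemma apply_linf_cscale [simp]: "apply_bcontfun (linf_cscale c f) x = c * f x"
  by (simp add: linf_cscale_def const_bcontfun.rep_eq)

lemma linf_dual_linear: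
  assumes "\<phi> \<in> linf_dual"
  shows "\<phi> (f + g) = \<phi> f + \<phi> g" "\<phi> (f - g) = \<phi> f - \<phi> g" "\<phi> (r *\<^sub>R f) = r *\<^sub>R \<phi> f"
    "\<phi> (linf_cscale c f) = c * \<phi> f"
proof -
  interpret bounded_linear \<phi> using assms by (simp add: linf_dual_def)
  show "\<phi> (f + g) = \<phi> f + \<phi> g" "\<phi> (f - g) = \<phi> f - \<phi> g" "\<phi> (r *\<^sub>R f) = r *\<^sub>R \<phi> f"
    by (rule add diff scaleR)+
  show "\<phi> (linf_cscale c f) = c * \<phi> f" using assms by (simp add: linf_dual_def)
qed

definition unit_on :: "'a::discrete_topology set \<Rightarrow> 'a linf set" where
  "unit_on S = {h :: 'a linf. norm h \<le> 1 \<and> (\<forall>x. x \<notin> S \<longrightarrow> apply_bcontfun h x = 0)}"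

text \<open>The total variation on \<open>S\<close> of the finitely additive complex measure
  representing \<open>\<phi>\<close>, obtained by duality from the functions in the unit ball
  supported in \<open>S\<close>.\<close>

definition variation :: "('a::discrete_topology linf \<Rightarrow> complex) \<Rightarrow> 'a set \<Rightarrow> real" where
  "variation \<phi> S = (SUP h\<in>unit_on S. norm (\<phi> h))"

lemma linf_ind_split: "(h :: ('a::discrete_topology) linf) = linf_mult (linf_ind S) h + linf_mult (linf_ind (- S)) h"
  by (rule bcontfun_eqI) (simp add: plus_bcontfun.rep_eq)

lemma
  assumes "\<phi> \<in> linf_dual"
  shows norm_le_variation: "h \<in> unit_on S \<Longrightarrow> norm (\<phi> h) \<le> variation \<phi> S"
    and variation_nonneg: "0 \<le> variation \<phi> S"
    and variation_least: "(\<And>h. h \<in> unit_on S \<Longrightarrow> norm (\<phi> h) \<le> b) \<Longrightarrow> variation \<phi> S \<le> b"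
proof -
  from assms obtain K where K: "\<And>h. norm (\<phi> h) \<le> norm h * K" "K > 0"
    using bounded_linear.pos_bounded unfolding linf_dual_def by blast
  have "norm (\<phi> h) \<le> K" if "h \<in> unit_on S" for h
  proof -
    have "norm h * K \<le> 1 * K" using that K(2) by (intro mult_right_mono) (auto simp: unit_on_def)
    with K(1)[of h] show ?thesis by simp
  qed
  then have bdd: "bdd_above ((\<lambda>h. norm (\<phi> h)) ` unit_on S)" by (auto simp: bdd_above_def)
  show le: "norm (\<phi> h) \<le> variation \<phi> S" if "h \<in> unit_on S" for h
    unfolding variation_def using that bdd by (rule cSUP_upper)
  have 0: "0 \<in> unit_on S" by (simp add: unit_on_def)
  show "0 \<le> variation \<phi> S" using le[OF 0] norm_ge_zero order_trans by blast
  show "variation \<phi> S \<le> b" if "\<And>h. h \<in> unit_on S \<Longrightarrow> norm (\<phi> h) \<le> b"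
    unfolding variation_def using 0 that by (intro cSUP_least) auto
qed

text \<open>Cutting a test function with indicators gives subadditivity. For the reverse, test
  functions on \<open>S\<close> and \<open>T\<close> are rotated until their values under
  \<open>\<phi>\<close> are nonnegative; their sum still has norm at most 1 as the supports are
  disjoint.\<close>

lemma variation_add:
  assumes "\<phi> \<in> linf_dual" "S \<inter> T = {}"
  shows "variation \<phi> (S \<union> T) = variation \<phi> S + variation \<phi> T"
proof (rule antisym)
  note lin = linf_dual_linear[OF assms(1)]
  show "variation \<phi> (S \<union> T) \<le> variation \<phi> S + variation \<phi> T"
  proof (rule variation_least[OF assms(1)])
    fix h assume h: "h \<in> unit_on (S \<union> T)"
    have nh: "norm (apply_bcontfun h x) \<le> 1" for x using norm_bounded[of h x] h by (simp add: unit_on_def)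
    have "linf_mult (linf_ind S) h \<in> unit_on S" "linf_mult (linf_ind (- S)) h \<in> unit_on T"
      using h by (auto simp: unit_on_def nh intro!: norm_bound)
    then have "norm (\<phi> (linf_mult (linf_ind S) h)) + norm (\<phi> (linf_mult (linf_ind (- S)) h))
        \<le> variation \<phi> S + variation \<phi> T"
      by (intro add_mono norm_le_variation[OF assms(1)])
    moreover have "\<phi> h = \<phi> (linf_mult (linf_ind S) h) + \<phi> (linf_mult (linf_ind (- S)) h)"
      using linf_ind_split[of h S] lin(1) by metis
    ultimately show "norm (\<phi> h) \<le> variation \<phi> S + variation \<phi> T"
      using norm_triangle_ineq by (metis order_trans)
  qed
  have sum_le: "norm (\<phi> g) + norm (\<phi> h) \<le> variation \<phi> (S \<union> T)"
    if g: "g \<in> unit_on S" and h: "h \<in> unit_on T" for g h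
  proof -
    define u where "u = linf_cscale (cnj (sgn (\<phi> g))) g + linf_cscale (cnj (sgn (\<phi> h))) h"
    have *: "cnj (sgn z) * z = of_real (norm z)" for z :: complex
      by (cases "z = 0")
        (simp_all add: sgn_div_norm scaleR_conv_of_real complex_norm_square[symmetric] mult.commute
          power2_eq_square field_simps flip: complex_norm_square)
    have "norm (u x) \<le> 1" for x
    proof -
      have b: "norm (cnj (sgn z) * k x) \<le> 1" if "norm k \<le> 1" for z and k :: "'a linf"
        using norm_bounded[of k x] that by (simp add: norm_mult norm_sgn)
      have "x \<notin> S \<or> x \<notin> T" using assms(2) by blast
      then show ?thesis using g h b[of g] b[of h] by (auto simp: u_def plus_bcontfun.rep_eq unit_on_def)
    qed
    then have "u \<in> unit_on (S \<union> T)"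
      using g h by (auto simp: unit_on_def u_def plus_bcontfun.rep_eq intro!: norm_bound)
    then have "norm (\<phi> u) \<le> variation \<phi> (S \<union> T)" by (rule norm_le_variation[OF assms(1)])
    moreover have "\<phi> u = of_real (norm (\<phi> g) + norm (\<phi> h))"
      unfolding u_def lin * by simp
    ultimately show ?thesis by (simp only: norm_of_real abs_of_nonneg add_nonneg_nonneg norm_ge_zero)
  qed
  then have "norm (\<phi> g) \<le> variation \<phi> (S \<union> T) - variation \<phi> T" if "g \<in> unit_on S" for g
  proof -
    have "variation \<phi> T \<le> variation \<phi> (S \<union> T) - norm (\<phi> g)"
      by (rule variation_least[OF assms(1)]) (use sum_le[OF that] in \<open>simp add: algebra_simps\<close>)
    then show ?thesis by simp
  qed
  then have "variation \<phi> S \<le> variation \<phi> (S \<union> T) - variation \<phi> T"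
    by (rule variation_least[OF assms(1)])
  then show "variation \<phi> S + variation \<phi> T \<le> variation \<phi> (S \<union> T)" by simp
qed

lemma norm_le_variation_scaled:
  assumes "\<phi> \<in> linf_dual" "\<And>x. norm (apply_bcontfun h x) \<le> c"
    "\<And>x. x \<notin> S \<Longrightarrow> apply_bcontfun h x = 0" "c > 0"
  shows "norm (\<phi> h) \<le> c * variation \<phi> S"
proof -
  have "(1 / c) *\<^sub>R h \<in> unit_on S"
    using assms by (auto simp: unit_on_def divide_le_eq_1 intro!: norm_bound)
  then have "norm (\<phi> ((1 / c) *\<^sub>R h)) \<le> variation \<phi> S" by (rule norm_le_variation[OF assms(1)])
  then show ?thesis using \<open>c > 0\<close> by (simp add: linf_dual_linear[OF assms(1)] field_simps)
qed

text \<open>The part of \<open>h n\<close> of modulus below \<open>\<delta>\<close> contributes at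
  most \<open>e / 2\<close> to \<open>\<phi>\<close>, so the sets where the modulus is at least
  \<open>\<delta>\<close> have variation bounded below, and one ultrafilter contains infinitely many
  of them.\<close>

lemma not_weakly_null:
  fixes h :: "nat \<Rightarrow> 'a::discrete_topology linf"
  assumes \<phi>: "\<phi> \<in> linf_dual" and h: "\<And>n. norm (h n) \<le> K" and e: "e > 0" "\<And>n. e \<le> norm (\<phi> (h n))"
  shows "\<exists>\<delta>>0. \<exists>P. ultra P \<and> infinite {n. \<forall>\<^sub>F s in P. \<delta> \<le> norm (h n s)}"
proof -
  \<comment> \<open>Adding 1 to the variation, and later to \<open>K\<close>, keeps the denominators
    positive.\<close>
  define \<delta> where "\<delta> = e / (2 * (variation \<phi> UNIV + 1))"
  have v: "0 \<le> variation \<phi> S" for S by (rule variation_nonneg[OF \<phi>])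
  have \<delta>: "\<delta> > 0" using e v[of UNIV] by (simp add: \<delta>_def)
  have \<delta>': "\<delta> * variation \<phi> UNIV \<le> e / 2" using e v[of UNIV] by (simp add: \<delta>_def field_simps)
  define A where "A n = {s. \<delta> \<le> norm (h n s)}" for n
  have K: "K \<ge> 0" using h[of 0] norm_ge_zero order_trans by blast
  have hK: "norm (h n s) \<le> K + 1" for n s using norm_bounded[of "h n" s] h[of n] by simp
  have "e / (2 * (K + 1)) \<le> variation \<phi> (A n)" for n
  proof -
    have "\<phi> (h n) = \<phi> (linf_mult (linf_ind (A n)) (h n)) + \<phi> (linf_mult (linf_ind (- A n)) (h n))"
      using linf_ind_split[of "h n" "A n"] linf_dual_linear(1)[OF \<phi>] by metis
    then have "norm (\<phi> (h n)) \<le> norm (\<phi> (linf_mult (linf_ind (A n)) (h n)))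
        + norm (\<phi> (linf_mult (linf_ind (- A n)) (h n)))"
      by (simp add: norm_triangle_ineq)
    also have "\<dots> \<le> (K + 1) * variation \<phi> (A n) + \<delta> * variation \<phi> UNIV"
      using K \<delta> hK[of n]
      by (intro add_mono norm_le_variation_scaled[OF \<phi>]) (auto simp: A_def)
    finally show ?thesis using e(2)[of n] \<delta>' K by (simp add: field_simps)
  qed
  then have "\<exists>P. ultra P \<and> infinite {n. \<forall>\<^sub>F s in P. s \<in> A n}"
    using e K by (intro ultra_in_infinitely_many[where \<mu> = "variation \<phi>" and e = "e / (2 * (K + 1))"])
      (auto simp: v variation_add[OF \<phi>])
  then show ?thesis using \<delta> by (auto simp: A_def)
qed

section \<open>Grothendieck's double limit criterion\<close>

text \<open>The double limit condition with ultrafilters in place of pairs of sequences, so that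
  both iterated limits of a bounded function always exist.\<close>

definition iterated_limits_commute :: "('a::plus \<Rightarrow> complex) \<Rightarrow> bool" where
  "iterated_limits_commute f \<longleftrightarrow> (\<forall>P Q. ultra P \<longrightarrow> ultra Q \<longrightarrow>
     Lim (iterf (+) P Q) f = Lim (iterf (\<lambda>t s. s + t) Q P) f)"

lemma bounded_range_linf:
  fixes f :: "'a::discrete_topology linf"
  shows "bounded (range f)" "bounded (range (\<lambda>x. f (h x)))"
  using norm_bounded[of f] by (auto simp: bounded_iff)

lemma bounded_range_Lim:
  fixes f :: "'a::discrete_topology linf"
  assumes "ultra Q"
  shows "bounded (range (\<lambda>s. Lim Q (\<lambda>t. f (h s t))))"
  using norm_Lim_le[OF assms norm_bounded[of f]] by (auto simp: bounded_iff)

lemma Lim_in_linf_dual: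
  fixes P :: "'a::discrete_topology filter"
  assumes "ultra P"
  shows "(\<lambda>f. Lim P (apply_bcontfun f)) \<in> linf_dual"
proof -
  note t = ultra_tendsto[OF assms bounded_range_linf(1)]
  note eq = ultra_Lim_eq[OF assms]
  have "bounded_linear (\<lambda>f :: 'a linf. Lim P (apply_bcontfun f))"
  proof (rule bounded_linear_intro[where K = 1])
    fix f g :: "'a linf" and r :: real
    show "Lim P (apply_bcontfun (f + g)) = Lim P (apply_bcontfun f) + Lim P (apply_bcontfun g)"
      unfolding plus_bcontfun.rep_eq by (rule eq) (intro tendsto_add t)
    show "Lim P (apply_bcontfun (r *\<^sub>R f)) = r *\<^sub>R Lim P (apply_bcontfun f)"
      unfolding scaleR_bcontfun.rep_eq by (rule eq) (intro tendsto_scaleR tendsto_const t)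
    show "norm (Lim P (apply_bcontfun f)) \<le> norm f * 1"
      using norm_Lim_le[OF assms norm_bounded] by simp
  qed
  moreover have "Lim P (apply_bcontfun (linf_cscale c f)) = c * Lim P (apply_bcontfun f)"
    for c and f :: "'a linf"
    unfolding apply_linf_cscale by (rule eq) (intro tendsto_mult tendsto_const t)
  ultimately show ?thesis by (simp add: linf_dual_def)
qed

lemma eval_in_linf_dual: "(\<lambda>f. apply_bcontfun f s) \<in> linf_dual"
  using Lim_in_linf_dual[OF ultra_principal[of s]] by (simp add: Lim_principal)

lemma openin_linf_weak:
  "\<phi> \<in> linf_dual \<Longrightarrow> open U \<Longrightarrow> openin linf_weak (\<phi> -` U)"
  unfolding linf_weak_def by (rule topology_generated_by_Basis) auto

text \<open>By weak compactness the translates \<open>linf_R t f\<close> converge weakly to some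
  \<open>g\<close> along \<open>Q\<close>. Evaluation at \<open>s\<close> identifies
  \<open>g\<close> as the inner limit along \<open>Q\<close>, and the functional
  \<open>Lim P\<close> then exchanges the two limits.\<close>

lemma WAP_imp_commute:
  fixes f :: "'a::{group_add,discrete_topology} linf"
  assumes "f \<in> WAP"
  shows "iterated_limits_commute f"
  unfolding iterated_limits_commute_def
proof (intro allI impI)
  fix P Q :: "'a filter" assume PQ: "ultra P" "ultra Q"
  let ?K = "linf_weak closure_of range (\<lambda>t. linf_R t f)"
  have K: "compactin linf_weak ?K" using assms by (simp add: WAP_def)
  have "\<exists>g\<in>?K. \<forall>\<phi>\<in>linf_dual. ((\<lambda>t. \<phi> (linf_R t f)) \<longlongrightarrow> \<phi> g) Q"
  proof (rule ccontr)
    assume no: "\<not> ?thesis"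
    \<comment> \<open>If no point of the compact set were a weak limit, these open sets would cover
      it. A finite subcover contains the orbit, so one of its members would be met eventually along
      \<open>Q\<close>, contrary to the choice.\<close>
    define \<U> where "\<U> = {\<phi> -` U | \<phi> U. \<phi> \<in> linf_dual \<and> open U \<and> \<not> (\<forall>\<^sub>F t in Q. linf_R t f \<in> \<phi> -` U)}"
    have "?K \<subseteq> \<Union>\<U>"
    proof
      fix g assume "g \<in> ?K"
      with no obtain \<phi> where \<phi>: "\<phi> \<in> linf_dual" "\<not> ((\<lambda>t. \<phi> (linf_R t f)) \<longlongrightarrow> \<phi> g) Q" by blast
      then obtain U where "open U" "\<phi> g \<in> U" "\<not> (\<forall>\<^sub>F t in Q. \<phi> (linf_R t f) \<in> U)"
        by (auto simp: tendsto_def)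
      with \<phi>(1) have "\<phi> -` U \<in> \<U>" "g \<in> \<phi> -` U" by (auto simp: \<U>_def)
      then show "g \<in> \<Union>\<U>" by (rule UnionI)
    qed
    moreover have "openin linf_weak U" if "U \<in> \<U>" for U
      using that openin_linf_weak by (auto simp: \<U>_def)
    ultimately obtain \<F> where \<F>: "finite \<F>" "\<F> \<subseteq> \<U>" "?K \<subseteq> \<Union>\<F>"
      using K[unfolded compactin_def, THEN conjunct2, rule_format, of \<U>] by blast
    have "range (\<lambda>t. linf_R t f) \<subseteq> ?K" by (intro closure_of_subset) (simp add: topspace_linf_weak)
    then have "\<forall>\<^sub>F t in Q. \<exists>U\<in>\<F>. linf_R t f \<in> U" using \<F>(3) by (intro always_eventually) blast
    then obtain U where "U \<in> \<F>" "\<forall>\<^sub>F t in Q. linf_R t f \<in> U"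
      unfolding ultra_Bex[OF PQ(2) \<F>(1)] ..
    with \<F>(2) show False by (auto simp: \<U>_def)
  qed
  then obtain g where g: "\<And>\<phi>. \<phi> \<in> linf_dual \<Longrightarrow> Lim Q (\<lambda>t. \<phi> (linf_R t f)) = \<phi> g"
    using ultra_Lim_eq[OF PQ(2)] by blast
  have "Lim Q (\<lambda>t. f (s + t)) = g s" for s
    using g[OF eval_in_linf_dual[of s]] by simp
  moreover have "Lim Q (\<lambda>t. Lim P (\<lambda>s. f (s + t))) = Lim P g"
  proof -
    have "apply_bcontfun (linf_R t f) = (\<lambda>s. f (s + t))" for t by (rule ext) simp
    with g[OF Lim_in_linf_dual[OF PQ(1)]] show ?thesis by simp
  qed
  ultimately show "Lim (iterf (+) P Q) f = Lim (iterf (\<lambda>t s. s + t) Q P) f"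
    by (simp add: Lim_iterf PQ bounded_range_linf)
qed

text \<open>The pointwise limit along \<open>Q\<close> of the right translates of \<open>f\<close>,
  the only candidate for their weak limit.\<close>

definition linf_lim :: "'a filter \<Rightarrow> 'a::{group_add,discrete_topology} linf \<Rightarrow> 'a linf" where
  "linf_lim Q f = Bcontfun (\<lambda>s. Lim Q (\<lambda>t. f (s + t)))"

lemma apply_linf_lim: "ultra Q \<Longrightarrow> apply_bcontfun (linf_lim Q f) s = Lim Q (\<lambda>t. f (s + t))"
  unfolding linf_lim_def using bounded_range_Lim[of Q f "(+)"]
  by (subst Bcontfun_inverse) (auto simp: bcontfun_discrete_iff)

lemma norm_linf_lim_le: "ultra Q \<Longrightarrow> norm (linf_lim Q f) \<le> norm f"
  by (auto simp: apply_linf_lim intro!: norm_bound norm_Lim_le norm_bounded)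

text \<open>
  Countability of the group lets a sequence replace the ultrafilter \<open>Q\<close>, and for bounded
  sequences weak convergence to \<open>0\<close> can be tested on ultrafilters.
\<close>

lemma weak_tendsto_linf_lim:
  fixes f :: "'a::{group_add,countable,discrete_topology} linf"
  assumes comm: "iterated_limits_commute f" and Q: "ultra Q" and \<phi>: "\<phi> \<in> linf_dual"
  shows "((\<lambda>t. \<phi> (linf_R t f)) \<longlongrightarrow> \<phi> (linf_lim Q f)) Q"
proof (rule ccontr)
  let ?G = "linf_lim Q f"
  assume "\<not> ?thesis"
  then obtain e where e: "e > 0" "\<not> (\<forall>\<^sub>F t in Q. dist (\<phi> (linf_R t f)) (\<phi> ?G) < e)"
    unfolding tendsto_iff by blast
  then have ev: "\<forall>\<^sub>F t in Q. e \<le> dist (\<phi> (linf_R t f)) (\<phi> ?G)"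
    using ultra_not[OF Q] by (simp add: not_less[symmetric])
  \<comment> \<open>A single \<open>t\<close> can be close to the limit at the finitely many
    \<open>s\<close> enumerated up to \<open>n\<close> and still stay \<open>e\<close> away under
    \<open>\<phi>\<close>.\<close>
  have "\<exists>t. e \<le> dist (\<phi> (linf_R t f)) (\<phi> ?G) \<and>
    (\<forall>s\<in>to_nat -` {..n}. dist (f (s + t)) (?G s) < inverse (real (Suc n)))" for n
  proof -
    have "\<forall>\<^sub>F t in Q. dist (f (s + t)) (?G s) < inverse (real (Suc n))" for s
    proof -
      have "((\<lambda>t. f (s + t)) \<longlongrightarrow> ?G s) Q"
        unfolding apply_linf_lim[OF Q] by (intro ultra_tendsto Q bounded_range_linf)
      then show ?thesis by (rule tendstoD) simp
    qed
    then have "\<forall>\<^sub>F t in Q. \<forall>s\<in>to_nat -` {..n}. dist (f (s + t)) (?G s) < inverse (real (Suc n))"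
      by (intro eventually_ball_finite finite_vimageI) auto
    with ev have "\<forall>\<^sub>F t in Q. e \<le> dist (\<phi> (linf_R t f)) (\<phi> ?G) \<and>
        (\<forall>s\<in>to_nat -` {..n}. dist (f (s + t)) (?G s) < inverse (real (Suc n)))"
      by (rule eventually_conj)
    then show ?thesis using eventually_happens'[OF ultra_not_bot[OF Q]] by blast
  qed
  then obtain \<tau> where \<tau>: "\<And>n. e \<le> dist (\<phi> (linf_R (\<tau> n) f)) (\<phi> ?G)"
    "\<And>n s. to_nat s \<le> n \<Longrightarrow> dist (f (s + \<tau> n)) (?G s) < inverse (real (Suc n))"
    by (metis atMost_iff vimage_eq)
  have lim: "(\<lambda>n. f (s + \<tau> n)) \<longlonglongrightarrow> ?G s" for s
  proof (rule metric_tendsto_imp_tendsto[OF LIMSEQ_inverse_real_of_nat])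
    show "\<forall>\<^sub>F n in sequentially. dist (f (s + \<tau> n)) (?G s) \<le> dist (inverse (real (Suc n))) 0"
      using eventually_ge_at_top[of "to_nat s"]
      by eventually_elim (use \<tau>(2) in \<open>force intro: less_imp_le\<close>)
  qed
  define h where "h n = linf_R (\<tau> n) f - ?G" for n
  have "norm (h n) \<le> 2 * norm f" for n
  proof -
    have "norm (linf_R (\<tau> n) f) \<le> norm f" by (rule norm_bound) (simp add: norm_bounded)
    then show ?thesis
      using norm_triangle_ineq4[of "linf_R (\<tau> n) f" ?G] norm_linf_lim_le[OF Q, of f]
      by (simp add: h_def)
  qed
  moreover have "e \<le> norm (\<phi> (h n))" for n
    using \<tau>(1)[of n] by (simp add: h_def dist_norm linf_dual_linear[OF \<phi>])
  ultimately obtain \<delta> P where \<delta>: "\<delta> > 0" and P: "ultra P"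
    and inf: "infinite {n. \<forall>\<^sub>F s in P. \<delta> \<le> norm (h n s)}"
    using not_weakly_null[OF \<phi> _ e(1)] by blast
  obtain U where U: "ultra U" "U \<le> sequentially" "\<forall>\<^sub>F n in U. \<forall>\<^sub>F s in P. \<delta> \<le> norm (h n s)"
    using free_ultra_exists[OF inf] by (auto simp: cofinite_eq_sequentially)
  \<comment> \<open>Along this ultrafilter the translates have the same pointwise limit as along
    \<open>Q\<close>, and now \<open>P\<close> is known to see the differences
    \<open>h n\<close>.\<close>
  let ?Q' = "filtermap \<tau> U"
  have Q': "ultra ?Q'" using U(1) by (rule ultra_filtermap)
  have "Lim ?Q' (\<lambda>t. f (s + t)) = ?G s" for s
    by (rule ultra_Lim_eq[OF Q']) (auto simp: filterlim_filtermap intro: tendsto_mono[OF U(2) lim])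
  then have "Lim P ?G = Lim P (\<lambda>s. Lim ?Q' (\<lambda>t. f (s + t)))" by simp
  also have "\<dots> = Lim ?Q' (\<lambda>t. Lim P (\<lambda>s. f (s + t)))"
    using comm P Q' by (simp add: iterated_limits_commute_def Lim_iterf bounded_range_linf)
  finally have "Lim P ?G = Lim ?Q' (\<lambda>t. Lim P (\<lambda>s. f (s + t)))" .
  then have "((\<lambda>t. Lim P (\<lambda>s. f (s + t))) \<longlongrightarrow> Lim P ?G) ?Q'"
    using ultra_tendsto[OF Q' bounded_range_Lim[OF P, of f "\<lambda>t s. s + t"]] by simp
  then have "((\<lambda>n. Lim P (\<lambda>s. f (s + \<tau> n))) \<longlongrightarrow> Lim P ?G) U"
    by (simp add: filterlim_filtermap)
  then have "\<forall>\<^sub>F n in U. dist (Lim P (\<lambda>s. f (s + \<tau> n))) (Lim P ?G) < \<delta>"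
    using \<delta> by (rule tendstoD)
  \<comment> \<open>For such \<open>n\<close> the limit of \<open>norm (h n s)\<close> along
    \<open>P\<close> is at least \<open>\<delta>\<close>, whereas the exchange of limits puts it
    below \<open>\<delta>\<close>.\<close>
  with U(3) have "\<forall>\<^sub>F n in U. False"
  proof eventually_elim
    case (elim n)
    have "((\<lambda>s. dist (f (s + \<tau> n)) (?G s)) \<longlongrightarrow> dist (Lim P (\<lambda>s. f (s + \<tau> n))) (Lim P ?G)) P"
      by (intro tendsto_dist ultra_tendsto P bounded_range_linf)
    then have "\<delta> \<le> dist (Lim P (\<lambda>s. f (s + \<tau> n))) (Lim P ?G)"
      using elim(1) ultra_not_bot[OF P]
      by (intro tendsto_lowerbound) (auto simp: h_def dist_norm minus_bcontfun.rep_eq)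
    with elim(2) show False by simp
  qed
  then show False using ultra_not_bot[OF U(1)] by simp
qed

lemma Hausdorff_space_linf_weak: "Hausdorff_space (linf_weak :: 'a::discrete_topology linf topology)"
  unfolding Hausdorff_space_def
proof (intro allI impI)
  fix f g :: "'a linf"
  assume "f \<in> topspace linf_weak \<and> g \<in> topspace linf_weak \<and> f \<noteq> g"
  then obtain s where "f s \<noteq> g s" using bcontfun_eqI by metis
  then obtain U V where UV: "open U" "open V" "f s \<in> U" "g s \<in> V" "U \<inter> V = {}"
    using hausdorff by metis
  then show "\<exists>U V. openin linf_weak U \<and> openin linf_weak V \<and> f \<in> U \<and> g \<in> V \<and> disjnt U V"
    using openin_linf_weak[OF eval_in_linf_dual[of s]]
    by (intro exI[of _ "(\<lambda>f. apply_bcontfun f s) -` U"] exI[of _ "(\<lambda>f. apply_bcontfun f s) -` V"])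
      (auto simp: disjnt_def)
qed

text \<open>Continuity of \<open>Q \<mapsto> linf_lim Q f\<close> from the space of ultrafilters to
  the weak topology: the ultrafilters containing \<open>S\<close> form a basic neighbourhood of
  \<open>Q\<close>. It is checked by induction on how \<open>U\<close> is generated.\<close>

lemma linf_lim_nhd:
  fixes f :: "'a::{group_add,countable,discrete_topology} linf"
  assumes comm: "iterated_limits_commute f" and "openin linf_weak U"
    and Q: "ultra Q" "linf_lim Q f \<in> U"
  shows "\<exists>S. (\<forall>\<^sub>F t in Q. t \<in> S) \<and> (\<forall>Q'. ultra Q' \<longrightarrow> (\<forall>\<^sub>F t in Q'. t \<in> S) \<longrightarrow> linf_lim Q' f \<in> U)"
proof -
  from assms(2) have "generate_topology_on {\<phi> -` U | \<phi> U. \<phi> \<in> linf_dual \<and> open U} U"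
    by (simp add: linf_weak_def openin_topology_generated_by_iff)
  then show ?thesis using Q(2)
  proof (induction rule: generate_topology_on.induct)
    case (Int A B)
    then obtain S T where "\<forall>\<^sub>F t in Q. t \<in> S" "\<forall>\<^sub>F t in Q. t \<in> T"
      "\<forall>Q'. ultra Q' \<longrightarrow> (\<forall>\<^sub>F t in Q'. t \<in> S) \<longrightarrow> linf_lim Q' f \<in> A"
      "\<forall>Q'. ultra Q' \<longrightarrow> (\<forall>\<^sub>F t in Q'. t \<in> T) \<longrightarrow> linf_lim Q' f \<in> B"
      by auto
    then show ?case by (intro exI[of _ "S \<inter> T"]) (auto simp: eventually_conj_iff)
  next
    case (UN K)
    then show ?case by blast
  next
    case (Basis B)
    then obtain \<phi> V where \<phi>: "\<phi> \<in> linf_dual" "open V" "B = \<phi> -` V" by auto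
    then obtain r where r: "r > 0" "ball (\<phi> (linf_lim Q f)) r \<subseteq> V"
      using Basis.prems openE by (metis vimage_eq)
    define S where "S = {t. dist (\<phi> (linf_lim Q f)) (\<phi> (linf_R t f)) < r / 2}"
    have "\<forall>\<^sub>F t in Q. t \<in> S"
      using tendstoD[OF weak_tendsto_linf_lim[OF comm Q(1) \<phi>(1)], of "r / 2"] r
      by (simp add: S_def dist_commute)
    moreover have "linf_lim Q' f \<in> B" if Q': "ultra Q'" "\<forall>\<^sub>F t in Q'. t \<in> S" for Q'
    proof -
      have "dist (\<phi> (linf_lim Q f)) (\<phi> (linf_lim Q' f)) \<le> r / 2"
        using Q'(2) ultra_not_bot[OF Q'(1)] weak_tendsto_linf_lim[OF comm Q'(1) \<phi>(1)]
        by (intro tendsto_upperbound[OF tendsto_dist[OF tendsto_const]])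
          (auto simp: S_def elim: eventually_mono)
      with r \<phi>(3) show ?thesis by auto
    qed
    ultimately show ?case by blast
  qed auto
qed

text \<open>\<open>K\<close> is the continuous image of the compact space of all ultrafilters. It
  contains the orbit, coming from principal ultrafilters, and is weakly closed because the weak
  topology is Hausdorff.\<close>

lemma commute_imp_WAP:
  fixes f :: "'a::{group_add,countable,discrete_topology} linf"
  assumes comm: "iterated_limits_commute f"
  shows "f \<in> WAP"
proof -
  define K where "K = (\<lambda>Q. linf_lim Q f) ` {Q. ultra Q}"
  have "compactin linf_weak K"
    unfolding compactin_def
  proof (intro conjI allI impI)
    fix \<U> assume \<U>: "Ball \<U> (openin linf_weak) \<and> K \<subseteq> \<Union>\<U>"
    have "\<exists>S U. (\<forall>\<^sub>F t in Q. t \<in> S) \<and> U \<in> \<U> \<and>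
        (\<forall>Q'. ultra Q' \<longrightarrow> (\<forall>\<^sub>F t in Q'. t \<in> S) \<longrightarrow> linf_lim Q' f \<in> U)" if "ultra Q" for Q
    proof -
      have "linf_lim Q f \<in> \<Union>\<U>" using that \<U> by (auto simp: K_def)
      then obtain U where "U \<in> \<U>" "linf_lim Q f \<in> U" by blast
      with linf_lim_nhd[OF comm _ that] \<U> show ?thesis by meson
    qed
    then obtain S U where S: "\<And>Q. ultra Q \<Longrightarrow> \<forall>\<^sub>F t in Q. t \<in> S Q"
      and U: "\<And>Q. ultra Q \<Longrightarrow> U Q \<in> \<U>"
      and SU: "\<And>Q Q'. ultra Q \<Longrightarrow> ultra Q' \<Longrightarrow> \<forall>\<^sub>F t in Q'. t \<in> S Q \<Longrightarrow> linf_lim Q' f \<in> U Q"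
      by metis
    \<comment> \<open>Otherwise the complements of the \<open>S Q\<close> generate a proper filter,
      and an ultrafilter \<open>Q\<close> below it would omit its own \<open>S Q\<close>.\<close>
    have "\<exists>I\<subseteq>{Q. ultra Q}. finite I \<and> (\<Union>Q\<in>I. S Q) = UNIV"
    proof (rule ccontr)
      assume no: "\<not> ?thesis"
      have "(INF Q\<in>{Q. ultra Q}. principal (- S Q)) \<noteq> bot"
      proof (rule INF_filter_not_bot)
        fix I assume "I \<subseteq> {Q :: 'a filter. ultra Q}" "finite I"
        with no have "(\<Union>Q\<in>I. S Q) \<noteq> UNIV" by simp
        then have "(\<Inter>Q\<in>I. - S Q) \<noteq> {}" by auto
        with \<open>finite I\<close> show "(INF Q\<in>I. principal (- S Q)) \<noteq> bot"
          by (simp add: INF_principal_finite principal_eq_bot_iff del: INF_eq_bot_iff Compl_INT)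
      qed
      then obtain Q where Q: "ultra Q" "Q \<le> (INF Q\<in>{Q. ultra Q}. principal (- S Q))"
        using ex_ultra_le by blast
      then have "Q \<le> principal (- S Q)" by (auto simp: le_INF_iff)
      then have "\<forall>\<^sub>F t in Q. t \<notin> S Q" by (simp add: le_principal)
      with S[OF Q(1)] ultra_not[OF Q(1)] show False by blast
    qed
    then obtain I where I: "I \<subseteq> {Q. ultra Q}" "finite I" "(\<Union>Q\<in>I. S Q) = UNIV" by blast
    have "K \<subseteq> \<Union>(U ` I)"
    proof
      fix g assume "g \<in> K"
      then obtain Q' where Q': "ultra Q'" "g = linf_lim Q' f" by (auto simp: K_def)
      have "\<forall>\<^sub>F t in Q'. \<exists>Q\<in>I. t \<in> S Q" using I(3) by (intro always_eventually) blast
      then obtain Q where "Q \<in> I" "\<forall>\<^sub>F t in Q'. t \<in> S Q" unfolding ultra_Bex[OF Q'(1) I(2)] ..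
      with SU Q' I(1) show "g \<in> \<Union>(U ` I)" by blast
    qed
    then show "\<exists>\<F>. finite \<F> \<and> \<F> \<subseteq> \<U> \<and> K \<subseteq> \<Union>\<F>"
      using I U by (intro exI[of _ "U ` I"]) auto
  qed (simp add: topspace_linf_weak)
  moreover have "linf_R t f = linf_lim (principal {t}) f" for t
    by (rule bcontfun_eqI) (simp add: apply_linf_lim ultra_principal Lim_principal)
  then have "range (\<lambda>t. linf_R t f) \<subseteq> K" by (auto simp: K_def ultra_principal intro!: imageI)
  ultimately have "linf_weak closure_of range (\<lambda>t. linf_R t f) \<subseteq> K" "compactin linf_weak K"
    by (blast intro: closure_of_minimal[THEN subsetD]
        compactin_imp_closedin[OF Hausdorff_space_linf_weak])+
  then show ?thesis by (auto simp: WAP_def intro: closed_compactin)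
qed

lemma WAP_iff_commute:
  fixes f :: "'a::{group_add,countable,discrete_topology} linf"
  shows "f \<in> WAP \<longleftrightarrow> iterated_limits_commute f"
  using WAP_imp_commute commute_imp_WAP by blast

section \<open>The weakly almost periodic compactification\<close>

lemma Lim_linf_mult:
  fixes f g :: "'a::discrete_topology linf"
  assumes "ultra R"
  shows "Lim R (apply_bcontfun (linf_mult f g)) = Lim R f * Lim R g"
  unfolding apply_linf_mult
  by (rule ultra_Lim_eq[OF assms]) (intro tendsto_mult ultra_tendsto assms bounded_range_linf)

lemma Lim_const: "ultra R \<Longrightarrow> Lim R (\<lambda>_. c) = (c :: complex)"
  by (rule ultra_Lim_eq) auto

lemmas Lim_linf_add = linf_dual_linear(1)[OF Lim_in_linf_dual]
lemmas Lim_linf_cscale = linf_dual_linear(4)[OF Lim_in_linf_dual]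

lemma Lim_filtermap: "Lim (filtermap h P) f = Lim P (\<lambda>x. f (h x))"
  by (simp add: Topological_Spaces.Lim_def filterlim_filtermap)

definition linf_cnj :: "'a::discrete_topology linf \<Rightarrow> 'a linf" where
  "linf_cnj f = Bcontfun (\<lambda>x. cnj (f x))"

lemma apply_linf_cnj [simp]: "apply_bcontfun (linf_cnj f) x = cnj (f x)"
  using bounded_range_linf(1)[of f]
  by (simp add: linf_cnj_def Bcontfun_inverse bcontfun_discrete_iff bounded_iff)

lemma apply_linf_lim_eq:
  "ultra Q \<Longrightarrow> apply_bcontfun (linf_lim Q f) = (\<lambda>s. Lim Q (\<lambda>t. f (s + t)))"
  by (rule ext) (rule apply_linf_lim)

lemma apply_linf_ind_eq: "apply_bcontfun (linf_ind S) = (\<lambda>x. if x \<in> S then 1 else 0)"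
  by (rule ext) simp

text \<open>Both products are ultrafilters, so the limit of \<open>h\<close> along either is
  \<open>F\<close> applied to limits of \<open>f\<close> and \<open>g\<close> that agree.\<close>

lemma WAP_combine:
  fixes f g h :: "'a::{group_add,countable,discrete_topology} linf"
  assumes "f \<in> WAP" "g \<in> WAP"
    and "\<And>R. ultra R \<Longrightarrow> Lim R (apply_bcontfun h) = F (Lim R f) (Lim R g)"
  shows "h \<in> WAP"
  using assms by (simp add: WAP_iff_commute iterated_limits_commute_def ultra_iterf)

lemma WAP_add:
  fixes f :: "'a::{group_add,countable,discrete_topology} linf"
  shows "f \<in> WAP \<Longrightarrow> g \<in> WAP \<Longrightarrow> f + g \<in> WAP"
  by (rule WAP_combine[of f g, where F = "(+)"]) (assumption | erule Lim_linf_add)+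

lemma WAP_mult:
  fixes f :: "'a::{group_add,countable,discrete_topology} linf"
  shows "f \<in> WAP \<Longrightarrow> g \<in> WAP \<Longrightarrow> linf_mult f g \<in> WAP"
  by (rule WAP_combine[of f g, where F = "(*)"]) (assumption | erule Lim_linf_mult)+

lemma WAP_cscale:
  fixes f :: "'a::{group_add,countable,discrete_topology} linf"
  shows "f \<in> WAP \<Longrightarrow> linf_cscale c f \<in> WAP"
  by (rule WAP_combine[of f f, where F = "\<lambda>x y. c * x"]) (assumption | erule Lim_linf_cscale)+

lemma WAP_cnj:
  fixes f :: "'a::{group_add,countable,discrete_topology} linf"
  assumes f: "f \<in> WAP"
  shows "linf_cnj f \<in> WAP"
proof (rule WAP_combine[OF f f, where F = "\<lambda>x y. cnj x"])
  fix R :: "'a filter" assume R: "ultra R"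
  have eq: "apply_bcontfun (linf_cnj f) = (\<lambda>x. cnj (f x))" by (rule ext) simp
  show "Lim R (apply_bcontfun (linf_cnj f)) = cnj (Lim R f)"
    unfolding eq by (intro ultra_Lim_eq[OF R] tendsto_cnj ultra_tendsto R bounded_range_linf)
qed

lemma WAP_inverse:
  fixes f :: "'a::{group_add,countable,discrete_topology} linf"
  assumes f: "f \<in> WAP" and e: "e > 0" "\<And>x. e \<le> norm (f x)"
  shows "\<exists>h\<in>WAP. \<forall>x. h x = inverse (f x)"
proof -
  have b: "norm (inverse (f x)) \<le> inverse e" for x
    using e(2)[of x] e(1) by (simp add: norm_inverse le_imp_inverse_le)
  define h where "h = Bcontfun (\<lambda>x. inverse (f x))"
  have h: "apply_bcontfun h = (\<lambda>x. inverse (f x))"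
    unfolding h_def using b by (subst Bcontfun_inverse) (auto simp: bcontfun_discrete_iff bounded_iff)
  have "h \<in> WAP"
  proof (rule WAP_combine[OF f f, where F = "\<lambda>x y. inverse x"])
    fix R :: "'a filter" assume R: "ultra R"
    have t: "(f \<longlongrightarrow> Lim R f) R" by (intro ultra_tendsto R bounded_range_linf)
    have "e \<le> norm (Lim R f)"
      using e(2) by (intro tendsto_lowerbound[OF tendsto_norm[OF t]] ultra_not_bot R) auto
 with e(1) have "Lim R f \<noteq> 0" by auto
    then show "Lim R (apply_bcontfun h) = inverse (Lim R f)"
      unfolding h by (intro ultra_Lim_eq[OF R] tendsto_inverse t)
  qed
  with h show ?thesis by (intro bexI[of _ h]) auto
qed

lemma WAP_const: "(const_bcontfun c :: 'a::{group_add,countable,discrete_topology} linf) \<in> WAP"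
  by (simp add: WAP_iff_commute iterated_limits_commute_def const_bcontfun.rep_eq Lim_const ultra_iterf)

text \<open>The limits for \<open>f\<close> are exchanged twice: \<open>P\<close> moves past the
  product of \<open>R\<close> and \<open>Q\<close>, and then a translate of \<open>P\<close> moves
  back past \<open>Q\<close> alone.\<close>

lemma linf_lim_WAP:
  fixes f :: "'a::{group_add,countable,discrete_topology} linf"
  assumes f: "f \<in> WAP" and Q: "ultra Q"
  shows "linf_lim Q f \<in> WAP"
proof -
  have comm: "Lim P (\<lambda>s. Lim R (\<lambda>t. f (s + t))) = Lim R (\<lambda>t. Lim P (\<lambda>s. f (s + t)))"
    if "ultra P" "ultra R" for P R :: "'a filter"
    using f that by (simp add: WAP_iff_commute iterated_limits_commute_def Lim_iterf bounded_range_linf)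
  have "Lim (iterf (+) P R) (linf_lim Q f) = Lim (iterf (\<lambda>t s. s + t) R P) (linf_lim Q f)"
    if P: "ultra P" and R: "ultra R" for P R :: "'a filter"
  proof -
    have RQ: "ultra (iterf (+) R Q)" by (rule ultra_iterf[OF R Q])
    have "Lim (iterf (+) P R) (linf_lim Q f) = Lim P (\<lambda>s. Lim R (\<lambda>t. Lim Q (\<lambda>u. f (s + (t + u)))))"
      by (simp add: Lim_iterf[OF P R bounded_range_linf(1)] apply_linf_lim[OF Q] add.assoc)
    also have "\<dots> = Lim P (\<lambda>s. Lim (iterf (+) R Q) (\<lambda>v. f (s + v)))"
      using R Q by (simp add: Lim_iterf bounded_range_linf)
    also have "\<dots> = Lim (iterf (+) R Q) (\<lambda>v. Lim P (\<lambda>s. f (s + v)))" by (rule comm[OF P RQ])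
    also have "\<dots> = Lim R (\<lambda>t. Lim Q (\<lambda>u. Lim P (\<lambda>s. f (s + (t + u)))))"
      by (rule Lim_iterf[OF R Q]) (rule bounded_range_Lim[OF P])
    \<comment> \<open>For fixed \<open>t\<close>, associativity lets \<open>t\<close> be absorbed
      into \<open>P\<close> by pushing \<open>P\<close> forward under right translation.\<close>
    also have "\<dots> = Lim R (\<lambda>t. Lim Q (\<lambda>u. Lim (filtermap (\<lambda>s. s + t) P) (\<lambda>s. f (s + u))))"
      by (simp add: Lim_filtermap add.assoc)
    also have "\<dots> = Lim R (\<lambda>t. Lim (filtermap (\<lambda>s. s + t) P) (\<lambda>s. Lim Q (\<lambda>u. f (s + u))))"
      using P Q by (simp add: comm ultra_filtermap)
    also have "\<dots> = Lim (iterf (\<lambda>t s. s + t) R P) (linf_lim Q f)"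
      by (simp add: Lim_iterf[OF R P bounded_range_linf(1)] apply_linf_lim[OF Q] Lim_filtermap)
    finally show ?thesis .
  qed
  then show ?thesis by (simp add: WAP_iff_commute iterated_limits_commute_def)
qed

section \<open>Points of the compactification as evaluations along ultrafilters\<close>

definition wap_ev :: "'a filter \<Rightarrow> 'a::{group_add,discrete_topology} linf \<Rightarrow> complex" where
  "wap_ev P = (\<lambda>f\<in>WAP. Lim P (apply_bcontfun f))"

lemma wap_ev_apply: "f \<in> WAP \<Longrightarrow> wap_ev P f = Lim P (apply_bcontfun f)"
  by (simp add: wap_ev_def)

lemma wap_point_eq_ev: "wap_point \<gamma> = wap_ev (principal {\<gamma>})"
  by (simp add: wap_point_def wap_ev_def Lim_principal)

lemma wap_ev_in_wap_space:
  fixes P :: "'a::{group_add,countable,discrete_topology} filter"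
  assumes "ultra P"
  shows "wap_ev P \<in> wap_space"
proof -
  have "wap_ev P (const_bcontfun 1) \<noteq> 0"
    using assms by (simp add: wap_ev_apply WAP_const const_bcontfun.rep_eq Lim_const)
  then have "\<exists>f\<in>WAP. wap_ev P f \<noteq> 0" using WAP_const by blast
  moreover have "wap_ev P (f + g) = wap_ev P f + wap_ev P g"
    "wap_ev P (linf_mult f g) = wap_ev P f * wap_ev P g"
    "wap_ev P (linf_cscale c f) = c * wap_ev P f" if "f \<in> WAP" "g \<in> WAP" for f g c
    unfolding wap_ev_apply[OF that(1)] wap_ev_apply[OF that(2)] wap_ev_apply[OF WAP_add[OF that]]
      wap_ev_apply[OF WAP_mult[OF that]] wap_ev_apply[OF WAP_cscale[OF that(1)]]
    by (rule Lim_linf_add[OF assms] Lim_linf_mult[OF assms] Lim_linf_cscale[OF assms])+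
  moreover have "wap_ev P \<in> extensional WAP" by (simp add: wap_ev_def)
  ultimately show ?thesis unfolding wap_space_def by blast
qed

text \<open>If no \<open>\<gamma>\<close> works, the sum of the squared distances
  \<open>norm (f x - \<xi> f)\<close> over \<open>X\<close> is at least \<open>e\<^sup>2\<close>
  everywhere. It lies in \<open>WAP\<close> and so does its inverse, yet \<open>\<xi>\<close> sends
  it to 0, contradicting that \<open>\<xi>\<close> maps the constant 1 to 1.\<close>

lemma wap_space_approx:
  fixes \<xi> :: "'a::{group_add,countable,discrete_topology} linf \<Rightarrow> complex"
  assumes \<xi>: "\<xi> \<in> wap_space" and X: "finite X" "X \<subseteq> WAP" and e: "e > 0"
  shows "\<exists>\<gamma>. \<forall>f\<in>X. norm (apply_bcontfun f \<gamma> - \<xi> f) < e"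
proof (rule ccontr)
  assume no: "\<not> ?thesis"
  have add: "\<xi> (f + g) = \<xi> f + \<xi> g" and mult: "\<xi> (linf_mult f g) = \<xi> f * \<xi> g"
    and scale: "\<xi> (linf_cscale c f) = c * \<xi> f" if "f \<in> WAP" "g \<in> WAP" for f g c
    using \<xi> that by (auto simp: wap_space_def)
  obtain u where u: "u \<in> WAP" "\<xi> u \<noteq> 0" using \<xi> by (auto simp: wap_space_def)
  have const: "\<xi> (const_bcontfun c) = c" for c
  proof -
    have "\<xi> (linf_cscale c u) = \<xi> (const_bcontfun c) * \<xi> u"
      unfolding linf_cscale_def by (rule mult[OF WAP_const u(1)])
    with scale[OF u(1) u(1), of c] u(2) show ?thesis by simp
  qed
  have "\<exists>h\<in>WAP. \<xi> h = 0 \<and> (\<forall>x. h x = of_real (\<Sum>f\<in>X. (norm (apply_bcontfun f x - \<xi> f))\<^sup>2))"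
    using X
  proof (induction X rule: finite_induct)
    case empty
    show ?case using const[of 0] by (intro bexI[OF _ WAP_const[of 0]]) (simp add: const_bcontfun.rep_eq)
  next
    case (insert f X)
    then obtain h where h: "h \<in> WAP" "\<xi> h = 0"
      "\<And>x. h x = of_real (\<Sum>f\<in>X. (norm (apply_bcontfun f x - \<xi> f))\<^sup>2)"
      by auto
    have f: "f \<in> WAP" using insert by simp
    define k where "k = f + const_bcontfun (- \<xi> f)"
    have k: "k \<in> WAP" "\<xi> k = 0" "\<And>x. k x = f x - \<xi> f"
      by (simp_all add: k_def WAP_add WAP_const f add const plus_bcontfun.rep_eq const_bcontfun.rep_eq)
    \<comment> \<open>This adds the squared modulus of \<open>k\<close>; \<open>\<xi>\<close> kills
      the new term because it kills the factor \<open>k\<close>.\<close>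
    define g where "g = h + linf_mult k (linf_cnj k)"
    have "g \<in> WAP" "\<xi> g = 0"
      using k by (simp_all add: g_def WAP_add WAP_mult WAP_cnj h add mult)
    moreover have "g x = of_real (\<Sum>f\<in>insert f X. (norm (apply_bcontfun f x - \<xi> f))\<^sup>2)" for x
      unfolding g_def using insert.hyps
      by (simp add: plus_bcontfun.rep_eq h(3) k(3) complex_norm_square[symmetric] of_real_power[symmetric]
          add.commute del: of_real_power complex_cnj_diff)
    ultimately show ?case by blast
  qed
  then obtain h where h: "h \<in> WAP" "\<xi> h = 0"
      "\<And>x. h x = of_real (\<Sum>f\<in>X. (norm (apply_bcontfun f x - \<xi> f))\<^sup>2)"
    by blast
  have lower: "e\<^sup>2 \<le> norm (h x)" for x
  proof -
    obtain f where f: "f \<in> X" "e \<le> norm (apply_bcontfun f x - \<xi> f)" using no by (auto simp: not_less)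
    then have "e\<^sup>2 \<le> (norm (apply_bcontfun f x - \<xi> f))\<^sup>2" using e by (intro power_mono) auto
    also have "\<dots> \<le> (\<Sum>f\<in>X. (norm (apply_bcontfun f x - \<xi> f))\<^sup>2)" using f X(1) by (intro member_le_sum) auto
    finally show ?thesis unfolding h(3) norm_of_real by simp
  qed
  then obtain k where k: "k \<in> WAP" "\<And>x. k x = inverse (h x)"
    using WAP_inverse[OF h(1), where e = "e\<^sup>2"] e by auto
  have "linf_mult h k = const_bcontfun 1"
  proof (rule bcontfun_eqI)
    fix x
    have "h x \<noteq> 0" using lower[of x] e by auto
    then show "linf_mult h k x = const_bcontfun 1 x" by (simp add: k(2) const_bcontfun.rep_eq)
  qed
  with mult[OF h(1) k(1)] const[of 1] h(2) show False by simp
qed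

text \<open>By \<open>wap_space_approx\<close> the sets on which finitely many \<open>f\<close> come
  close to \<open>\<xi> f\<close> have the finite intersection property, and along an ultrafilter
  containing all of them every \<open>f\<close> tends to \<open>\<xi> f\<close>.\<close>

lemma wap_space_eq_range_ev:
  "wap_space = wap_ev ` {P :: 'a::{group_add,countable,discrete_topology} filter. ultra P}"
proof (intro equalityI subsetI)
  fix \<xi> :: "'a linf \<Rightarrow> complex" assume \<xi>: "\<xi> \<in> wap_space"
  define S where "S = (\<lambda>(f :: 'a linf, e). {\<gamma>. norm (apply_bcontfun f \<gamma> - \<xi> f) < e})"
  have "(INF i\<in>WAP \<times> {0<..}. principal (S i)) \<noteq> bot"
  proof (rule INF_filter_not_bot)
    fix I :: "('a linf \<times> real) set" assume I: "I \<subseteq> WAP \<times> {0<..}" "finite I"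
    \<comment> \<open>Inserting 1 keeps the minimum defined and positive when \<open>I\<close> is
      empty.\<close>
    have "\<exists>\<gamma>. \<forall>f\<in>fst ` I. norm (apply_bcontfun f \<gamma> - \<xi> f) < Min (insert 1 (snd ` I))"
      using I by (intro wap_space_approx[OF \<xi>]) auto
    then obtain \<gamma> where \<gamma>: "\<And>f e. (f, e) \<in> I \<Longrightarrow> norm (apply_bcontfun f \<gamma> - \<xi> f) < Min (insert 1 (snd ` I))"
      by force
    have "\<gamma> \<in> S i" if "i \<in> I" for i
    proof -
      have "Min (insert 1 (snd ` I)) \<le> snd i" using I that by (intro Min_le) auto
      with \<gamma>[of "fst i" "snd i"] that show ?thesis by (simp add: S_def split_beta)
    qed
    then have "(\<Inter>i\<in>I. S i) \<noteq> {}" by blast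
    with I(2) show "(INF i\<in>I. principal (S i)) \<noteq> bot"
      by (simp add: INF_principal_finite principal_eq_bot_iff del: INF_eq_bot_iff)
  qed
  then obtain P where P: "ultra P" "P \<le> (INF i\<in>WAP \<times> {0<..}. principal (S i))"
    using ex_ultra_le by blast
  have "Lim P f = \<xi> f" if "f \<in> WAP" for f :: "'a linf"
  proof (rule ultra_Lim_eq[OF P(1)], rule tendstoI)
    fix e :: real assume "e > 0"
    then have "P \<le> principal (S (f, e))" using P(2) that by (auto simp: le_INF_iff)
    then show "\<forall>\<^sub>F x in P. dist (f x) (\<xi> f) < e" by (simp add: le_principal S_def dist_norm)
  qed
  moreover have "\<xi> \<in> extensional WAP" using \<xi> by (simp add: wap_space_def)
  ultimately have "\<xi> = wap_ev P" by (intro extensionalityI[of _ WAP]) (auto simp: wap_ev_def)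
  with P(1) show "\<xi> \<in> wap_ev ` {P. ultra P}" by blast
qed (auto intro: wap_ev_in_wap_space)

lemma wap_ev_commute:
  fixes P Q :: "'a::{group_add,countable,discrete_topology} filter"
  assumes "ultra P" "ultra Q"
  shows "wap_ev (iterf (\<lambda>t s. s + t) Q P) = wap_ev (iterf (+) P Q)"
  using assms unfolding wap_ev_def
  by (intro restrict_ext) (simp add: WAP_iff_commute iterated_limits_commute_def)

text \<open>The inner function is \<open>linf_lim Q f\<close>. It belongs to \<open>WAP\<close>, so
  \<open>wap_ev P\<close> evaluates it by a limit instead of returning
  \<open>undefined\<close>.\<close>

lemma wap_mult_ev:
  fixes P Q :: "'a::{group_add,countable,discrete_topology} filter"
  assumes "ultra P" "ultra Q"
  shows "wap_mult (wap_ev P) (wap_ev Q) = wap_ev (iterf (+) P Q)"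
  unfolding wap_mult_def wap_ev_def[of "iterf (+) P Q"]
proof (rule restrict_ext)
  fix f :: "'a linf" assume f: "f \<in> WAP"
  have "apply_bcontfun (linf_L s f) = (\<lambda>t. f (s + t))" for s by (rule ext) simp
  then have "Bcontfun (\<lambda>s. wap_ev Q (linf_L s f)) = linf_lim Q f"
    using f by (simp add: linf_lim_def wap_ev_apply linf_L_WAP)
  then show "wap_ev P (Bcontfun (\<lambda>s. wap_ev Q (linf_L s f))) = Lim (iterf (+) P Q) f"
    using f assms
    by (simp add: wap_ev_apply linf_lim_WAP Lim_iterf bounded_range_linf apply_linf_lim_eq)
qed

lemma topspace_wap_topology: "topspace wap_topology = wap_space"
  by (auto simp: wap_topology_def wap_space_def PiE_def)

lemma wap_cls_subset: "wap_cls B \<subseteq> wap_space"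
  unfolding wap_cls_def topspace_wap_topology[symmetric] by (rule closure_of_subset_topspace)

lemma openin_wap_eval:
  assumes "f \<in> WAP" "open U"
  shows "openin wap_topology {\<xi> \<in> wap_space. \<xi> f \<in> U}"
proof -
  have "continuous_map wap_topology euclidean (\<lambda>\<xi>. \<xi> f)"
    unfolding wap_topology_def
    by (rule continuous_map_from_subtopology[OF continuous_map_product_projection[OF assms(1)]])
  from openin_continuous_map_preimage[OF this] assms(2) show ?thesis
    by (simp add: topspace_wap_topology)
qed

lemma limitin_wap_point:
  fixes P :: "'a::{group_add,countable,discrete_topology} filter"
  assumes "ultra P"
  shows "limitin wap_topology wap_point (wap_ev P) P"
proof -
  have "((\<lambda>\<gamma>. wap_point \<gamma> f) \<longlongrightarrow> wap_ev P f) P" if "f \<in> WAP" for f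
    using that by (simp add: wap_point_def wap_ev_apply ultra_tendsto[OF assms] bounded_range_linf)
  then have "limitin (product_topology (\<lambda>_. euclidean) WAP) wap_point (wap_ev P) P"
    unfolding limitin_componentwise
    by (auto simp: wap_ev_def wap_point_def PiE_def)
  then show ?thesis
    using assms unfolding wap_topology_def
    by (auto simp: limitin_subtopology wap_point_eq_ev wap_ev_in_wap_space ultra_principal)
qed

lemma eventually_wap_point_in:
  fixes P :: "'a::{group_add,countable,discrete_topology} filter"
  assumes "ultra P" "openin wap_topology T" "wap_ev P \<in> T"
  shows "\<forall>\<^sub>F \<gamma> in P. wap_point \<gamma> \<in> T"
  using limitin_wap_point[OF assms(1)] assms(2,3) by (simp add: limitin_def)

lemma wap_ev_in_wap_cls:
  fixes P :: "'a::{group_add,countable,discrete_topology} filter"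
  assumes "ultra P" "\<forall>\<^sub>F \<gamma> in P. \<gamma> \<in> B"
  shows "wap_ev P \<in> wap_cls B"
  unfolding wap_cls_def in_closure_of topspace_wap_topology
proof (intro conjI allI impI wap_ev_in_wap_space assms(1))
  fix T assume "wap_ev P \<in> T \<and> openin wap_topology T"
  then have "\<forall>\<^sub>F \<gamma> in P. wap_point \<gamma> \<in> T" using eventually_wap_point_in[OF assms(1)] by blast
  with assms(2) have "\<forall>\<^sub>F \<gamma> in P. \<gamma> \<in> B \<and> wap_point \<gamma> \<in> T" by (rule eventually_conj)
  then show "\<exists>y. y \<in> wap_point ` B \<and> y \<in> T"
    using eventually_happens'[OF ultra_not_bot[OF assms(1)]] by blast
qed

text \<open>The indicator of \<open>B\<close> extends to a continuous function on the
  compactification with values 0 and 1, and the closure of \<open>B\<close> is the clopen set where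
  it is 1.\<close>

lemma
  fixes B :: "'a::{group_add,countable,discrete_topology} set"
  assumes "linf_ind B \<in> WAP"
  shows wap_ev_in_wap_cls_iff: "ultra P \<Longrightarrow> wap_ev P \<in> wap_cls B \<longleftrightarrow> (\<forall>\<^sub>F \<gamma> in P. \<gamma> \<in> B)"
    and openin_wap_cls: "openin wap_topology (wap_cls B)"
    and wap_cls_eq: "wap_cls B = {\<xi> \<in> wap_space. \<xi> (linf_ind B) = 1}"
proof -
  have ev: "wap_ev P (linf_ind B) = (if \<forall>\<^sub>F \<gamma> in P. \<gamma> \<in> B then 1 else 0)" if "ultra P" for P
    using that assms Lim_indicator[OF that, of B] by (simp add: wap_ev_apply apply_linf_ind_eq)
  show iff: "wap_ev P \<in> wap_cls B \<longleftrightarrow> (\<forall>\<^sub>F \<gamma> in P. \<gamma> \<in> B)" if P: "ultra P" for P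
  proof
    assume cl: "wap_ev P \<in> wap_cls B"
    show "\<forall>\<^sub>F \<gamma> in P. \<gamma> \<in> B"
    proof (rule ccontr)
      assume "\<not> ?thesis"
      then have "wap_ev P \<in> {\<xi> \<in> wap_space. \<xi> (linf_ind B) \<in> - {1}}"
        by (simp add: ev P wap_ev_in_wap_space)
      moreover have "openin wap_topology {\<xi> \<in> wap_space. \<xi> (linf_ind B) \<in> - {1}}"
        by (intro openin_wap_eval assms) auto
      ultimately have "\<exists>\<gamma>\<in>B. wap_point \<gamma> (linf_ind B) \<noteq> 1"
        using cl[unfolded wap_cls_def in_closure_of, THEN conjunct2, rule_format,
            of "{\<xi> \<in> wap_space. \<xi> (linf_ind B) \<in> - {1}}"] by auto
      then show False using assms by (auto simp: wap_point_def)
    qed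
  qed (rule wap_ev_in_wap_cls[OF P])
  show eq: "wap_cls B = {\<xi> \<in> wap_space. \<xi> (linf_ind B) = 1}"
    using wap_cls_subset[of B] by (force simp: wap_space_eq_range_ev iff ev split: if_splits)
  have "wap_cls B = {\<xi> \<in> wap_space. \<xi> (linf_ind B) \<in> - {0}}"
    unfolding eq by (auto simp: wap_space_eq_range_ev ev split: if_splits)
  then show "openin wap_topology (wap_cls B)"
    using openin_wap_eval[OF assms, of "- {0}"] by auto
qed

section \<open>Translation-finite sets and their indicators\<close>

lemma left_translate_eq: "left_translate \<gamma> A = {y. \<gamma> + y \<in> A}"
  by (force simp: left_translate_def image_iff add.assoc[symmetric])

lemma right_translate_eq: "right_translate \<gamma> A = {y. y + \<gamma> \<in> A}"
  by (force simp: right_translate_def image_iff)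

lemma LTF_iff: "LTF A \<longleftrightarrow> translation_finite (+) A"
  unfolding LTF_def translation_finite_def
  by (intro all_cong imp_cong refl ex_cong1 conj_cong arg_cong[where f = finite])
    (auto simp: left_translate_eq)

lemma RTF_iff: "RTF A \<longleftrightarrow> translation_finite (\<lambda>t s. s + t) A"
  unfolding RTF_def translation_finite_def
  by (intro all_cong imp_cong refl ex_cong1 conj_cong arg_cong[where f = finite])
    (auto simp: right_translate_eq)

lemma I_TF_iff: "A \<in> I_TF \<longleftrightarrow> translation_finite (+) A \<and> translation_finite (\<lambda>t s. s + t) A"
  by (simp add: I_TF_def I_LTF_def I_RTF_def LTF_iff RTF_iff)

lemma translation_finite_mono:
  assumes "translation_finite m A" "B \<subseteq> A"
  shows "translation_finite m B"
  using assms unfolding translation_finite_iff by (blast intro: eventually_mono)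

lemma translation_finite_finite:
  fixes m :: "'a \<Rightarrow> 'b \<Rightarrow> 'c"
  assumes "\<And>x. inj (m x)" "finite A"
  shows "translation_finite m A"
  unfolding translation_finite_def
proof (intro allI impI)
  fix D :: "'a set" assume "infinite D"
  then obtain x where "x \<in> D" using infinite_imp_nonempty by blast
  moreover have "finite {y. \<forall>x'\<in>{x}. m x' y \<in> A}"
    using finite_vimageI[OF assms(2) assms(1)[of x]] by (simp add: vimage_def)
  ultimately show "\<exists>F. finite F \<and> F \<subseteq> D \<and> finite {y. \<forall>x\<in>F. m x y \<in> A}"
    by (intro exI[of _ "{x}"]) simp
qed

lemma translation_finite_Compl_iff:
  "translation_finite m (- B) \<longleftrightarrow>
     (\<forall>P Q. ultra P \<longrightarrow> P \<le> cofinite \<longrightarrow> ultra Q \<longrightarrow> Q \<le> cofinite \<longrightarrow>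
       eventually (\<lambda>z. z \<in> B) (iterf m P Q))"
  unfolding translation_finite_iff by (simp add: ultra_iterf ultra_not)

lemma set_filter_translation_finite:
  fixes m :: "'a \<Rightarrow> 'b \<Rightarrow> 'c"
  assumes "infinite (UNIV :: 'a set)" "infinite (UNIV :: 'b set)"
  shows "set_filter UNIV {B. translation_finite m (- B)}"
  unfolding set_filter_def
proof (intro conjI ballI allI impI)
  show "UNIV \<in> {B. translation_finite m (- B)}"
    by (auto simp: translation_finite_iff eventually_iterf eventually_const_iff ultra_not_bot)
  obtain P :: "'a filter" and Q :: "'b filter" where "ultra P" "P \<le> cofinite" "ultra Q" "Q \<le> cofinite"
    using free_ultra_exists[OF assms(1)] free_ultra_exists[OF assms(2)] by blast
  then have "\<not> translation_finite m UNIV"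
    unfolding translation_finite_iff by auto
  then show "{} \<notin> {B. translation_finite m (- B)}" by simp
next
  fix A B assume "A \<in> {B. translation_finite m (- B)}" "B \<in> {B. translation_finite m (- B)}"
  then show "A \<inter> B \<in> {B. translation_finite m (- B)}"
    unfolding mem_Collect_eq translation_finite_Compl_iff by (simp add: eventually_conj_iff)
next
  fix A B assume "A \<in> {B. translation_finite m (- B)}" "A \<subseteq> B \<and> B \<subseteq> UNIV"
  then show "B \<in> {B. translation_finite m (- B)}"
    by (auto intro: translation_finite_mono)
qed simp

lemma inj_plus: "inj ((+) (x :: 'a::group_add))" "inj (\<lambda>y. y + x)"
  by (auto simp: inj_def)

lemma iterf_principal:
  "iterf m (principal {x}) Q = iterf (\<lambda>y x. m x y) Q (principal {x})"
  by (simp add: filter_eq_iff eventually_iterf eventually_principal)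

text \<open>If both ultrafilters are free, both limits are 0 by translation-finiteness; if one is
  principal, the two products coincide.\<close>

lemma linf_ind_WAP:
  fixes A B :: "'a::{group_add,countable,discrete_topology} set"
  assumes A: "A \<in> I_TF" and B: "B \<subseteq> A"
  shows "linf_ind B \<in> WAP"
  unfolding WAP_iff_commute iterated_limits_commute_def
proof (intro allI impI)
  fix P Q :: "'a filter" assume PQ: "ultra P" "ultra Q"
  have B: "translation_finite (+) B" "translation_finite (\<lambda>t s. s + t) B"
    using A B by (auto simp: I_TF_iff intro: translation_finite_mono)
  show "Lim (iterf (+) P Q) (linf_ind B) = Lim (iterf (\<lambda>t s. s + t) Q P) (linf_ind B)"
  proof (cases "P \<le> cofinite \<and> Q \<le> cofinite")
    case True
    with B PQ have "\<not> (\<forall>\<^sub>F x in iterf (+) P Q. x \<in> B)" "\<not> (\<forall>\<^sub>F x in iterf (\<lambda>t s. s + t) Q P. x \<in> B)"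
      unfolding translation_finite_iff by blast+
    with PQ show ?thesis by (simp add: apply_linf_ind_eq Lim_indicator ultra_iterf)
  next
    case False
    then have "iterf (+) P Q = iterf (\<lambda>t s. s + t) Q P"
      using ultra_eq_principal[OF PQ(1)] ultra_eq_principal[OF PQ(2)]
        iterf_principal[of "(+)"] iterf_principal[of "\<lambda>t s. s + t"] by metis
    then show ?thesis by simp
  qed
qed

text \<open>Finite sets are translation-finite. This is what makes the points of the group isolated
  and distinct in the compactification.\<close>

lemma linf_ind_singleton_WAP: "linf_ind {\<gamma> :: 'a::{group_add,countable,discrete_topology}} \<in> WAP"
  by (rule linf_ind_WAP[of "{\<gamma>}"]) (auto simp: I_TF_iff inj_plus intro!: translation_finite_finite)

lemma wap_ev_eq_point_iff:
  fixes P :: "'a::{group_add,countable,discrete_topology} filter"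
  assumes "ultra P"
  shows "wap_ev P = wap_point \<gamma> \<longleftrightarrow> P = principal {\<gamma>}"
proof
  assume "wap_ev P = wap_point \<gamma>"
  moreover have "wap_point \<gamma> \<in> wap_cls {\<gamma>}"
    unfolding wap_point_eq_ev by (intro wap_ev_in_wap_cls ultra_principal) (simp add: eventually_principal)
  ultimately have "\<forall>\<^sub>F x in P. x = \<gamma>"
    using wap_ev_in_wap_cls_iff[OF linf_ind_singleton_WAP assms] by simp
  then show "P = principal {\<gamma>}" using ultra_eq_principal_iff[OF assms] by blast
qed (simp add: wap_point_eq_ev)

lemma openin_wap_point: "openin wap_topology {wap_point (\<gamma> :: 'a::{group_add,countable,discrete_topology})}"
proof -
  from wap_cls_subset[of "{\<gamma>}"] have "wap_cls {\<gamma>} = {wap_point \<gamma>}"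
    using ultra_principal[of \<gamma>]
    by (auto simp: wap_space_eq_range_ev wap_point_eq_ev wap_ev_in_wap_cls_iff[OF linf_ind_singleton_WAP]
        ultra_eq_principal_iff[symmetric])
  then show ?thesis using openin_wap_cls[OF linf_ind_singleton_WAP[of \<gamma>]] by simp
qed

lemma wap_point_in_wap_cls_iff:
  fixes \<gamma> :: "'a::{group_add,countable,discrete_topology}"
  shows "wap_point \<gamma> \<in> wap_cls B \<longleftrightarrow> \<gamma> \<in> B"
proof
  assume "wap_point \<gamma> \<in> wap_cls B"
  then obtain b where "b \<in> B" "wap_point b = wap_point \<gamma>"
    unfolding wap_cls_def in_closure_of
    by (metis openin_wap_point[of \<gamma>] imageE singletonD singletonI)
  then show "\<gamma> \<in> B"
    using wap_ev_eq_point_iff[OF ultra_principal[of b], of \<gamma>] by (simp add: wap_point_eq_ev[of b] principal_inject)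
next
  assume "\<gamma> \<in> B"
  then show "wap_point \<gamma> \<in> wap_cls B"
    unfolding wap_point_eq_ev by (intro wap_ev_in_wap_cls ultra_principal) (simp add: eventually_principal)
qed

lemma wap_corona_eq:
  "wap_corona = wap_ev ` {P :: 'a::{group_add,countable,discrete_topology} filter. ultra P \<and> P \<le> cofinite}"
proof -
  have "wap_ev P \<in> range wap_point \<longleftrightarrow> \<not> P \<le> cofinite" if P: "ultra P" for P :: "'a filter"
  proof -
    have "wap_ev P \<in> range wap_point \<longleftrightarrow> (\<exists>\<gamma>. P = principal {\<gamma>})"
      using wap_ev_eq_point_iff[OF P] by (simp add: image_iff)
    then show ?thesis using ultra_eq_principal[OF P] not_principal_le_cofinite by metis
  qed
  then show ?thesis by (auto simp: wap_corona_def wap_space_eq_range_ev)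
qed

text \<open>Products of corona points are evaluations along products of free ultrafilters, and an
  open set misses a closure once it misses the set itself. In the converse direction the second
  product is handled by \<open>wap_ev_commute\<close>: it gives the same point as the first.\<close>

lemma I_TF_eq_I_W: "(I_TF :: 'a::{group_add,countable,discrete_topology} set set) = I_W"
proof (intro equalityI subsetI)
  fix A :: "'a set" assume A: "A \<in> I_TF"
  note W = linf_ind_WAP[OF A order.refl]
  have "wap_cls A \<inter> wap_corona_sq = {}"
  proof -
    have "wap_mult (wap_ev P) (wap_ev Q) \<notin> wap_cls A"
      if "ultra P" "P \<le> cofinite" "ultra Q" "Q \<le> cofinite" for P Q
      using A that by (simp add: wap_mult_ev wap_ev_in_wap_cls_iff[OF W] ultra_iterf I_TF_iff translation_finite_iff)
    then show ?thesis by (auto simp: wap_corona_sq_def wap_corona_eq)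
  qed
  then show "A \<in> I_W"
    unfolding I_W_def using openin_wap_cls[OF W] by (simp add: openin_Int_closure_of_eq_empty)
next
  fix A :: "'a set" assume A: "A \<in> I_W"
  have no: "wap_ev (iterf (+) P Q) \<notin> wap_cls A"
    if "ultra P" "P \<le> cofinite" "ultra Q" "Q \<le> cofinite" for P Q
  proof -
    have "wap_ev (iterf (+) P Q) \<in> wap_corona_sq"
      using that unfolding wap_corona_sq_def wap_corona_eq wap_mult_ev[OF that(1,3), symmetric] by blast
    moreover have "wap_cls A \<inter> wap_corona_sq = {}"
      using A openin_Int_closure_of_eq_empty unfolding I_W_def by blast
    ultimately show ?thesis by blast
  qed
  have "translation_finite (+) A"
    unfolding translation_finite_iff
    using no wap_ev_in_wap_cls[of _ A] ultra_iterf by blast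
  moreover have "translation_finite (\<lambda>t s. s + t) A"
    unfolding translation_finite_iff
    using no wap_ev_in_wap_cls[of _ A] ultra_iterf wap_ev_commute by metis
  ultimately show "A \<in> I_TF" by (simp add: I_TF_iff)
qed

text \<open>When the closure of \<open>B\<close> is open, \<open>wap_ev R\<close> lies in it exactly
  if \<open>R\<close> contains \<open>B\<close>. Both products have the same evaluation, so they
  contain the same subsets of \<open>A\<close>, and \<open>translation_finite_if_commute\<close>
  applies.\<close>

lemma I_TF_if_openin_wap_cls:
  fixes A :: "'a::{group_add,countable,discrete_topology} set"
  assumes "\<And>B. B \<subseteq> A \<Longrightarrow> openin wap_topology (wap_cls B)"
  shows "A \<in> I_TF"
proof -
  have "(\<forall>\<^sub>F z in iterf (+) P Q. z \<in> B) \<longleftrightarrow> (\<forall>\<^sub>F z in iterf (\<lambda>t s. s + t) Q P. z \<in> B)"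
    if "B \<subseteq> A" and PQ: "ultra P" "ultra Q" for B and P Q :: "'a filter"
  proof -
    have "(\<forall>\<^sub>F \<gamma> in R. \<gamma> \<in> B) \<longleftrightarrow> wap_ev R \<in> wap_cls B" if R: "ultra R" for R
    proof
      assume "wap_ev R \<in> wap_cls B"
      with eventually_wap_point_in[OF R assms[OF \<open>B \<subseteq> A\<close>]] show "\<forall>\<^sub>F \<gamma> in R. \<gamma> \<in> B"
        by (simp add: wap_point_in_wap_cls_iff)
    qed (rule wap_ev_in_wap_cls[OF R])
    with PQ show ?thesis by (simp add: ultra_iterf wap_ev_commute)
  qed
  then show ?thesis
    unfolding I_TF_iff by (intro conjI translation_finite_if_commute inj_plus) auto
qed

section \<open>The Cech-Stone compactification\<close>

text \<open>With \<open>sets_of\<close> this translates between ultrafilters on the set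
  \<open>S\<close> and filters on the whole type concentrated on \<open>S\<close>. The case of a
  proper subset \<open>S\<close> serves \<open>\<beta>A\<close> in \<open>I_IW\<close>.\<close>

definition filter_of :: "'a set \<Rightarrow> 'a set set \<Rightarrow> 'a filter" where
  "filter_of S p = Abs_filter (\<lambda>R. {x \<in> S. R x} \<in> p)"

definition sets_of :: "'a set \<Rightarrow> 'a filter \<Rightarrow> 'a set set" where
  "sets_of S P = {B. B \<subseteq> S \<and> (\<forall>\<^sub>F x in P. x \<in> B)}"

lemma eventually_filter_of:
  assumes "p \<in> beta S"
  shows "eventually R (filter_of S p) \<longleftrightarrow> {x \<in> S. R x} \<in> p"
proof -
  have p: "S \<in> p" "\<And>A B. A \<in> p \<Longrightarrow> B \<in> p \<Longrightarrow> A \<inter> B \<in> p"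
    "\<And>A B. A \<in> p \<Longrightarrow> A \<subseteq> B \<Longrightarrow> B \<subseteq> S \<Longrightarrow> B \<in> p"
    using assms by (auto simp: beta_def set_ultrafilter_def set_filter_def)
  show ?thesis
    unfolding filter_of_def
  proof (rule eventually_Abs_filter, rule is_filter.intro, goal_cases)
    case 1
    then show ?case using p(1) by simp
  next
    case (2 P Q)
    then show ?case using p(2)[OF 2] by (simp add: Collect_conj_eq[symmetric] Int_def cong: conj_cong)
  next
    case (3 P Q)
    then show ?case by (intro p(3)[OF 3(2)]) auto
  qed
qed

lemma ultra_filter_of:
  assumes "p \<in> beta S"
  shows "ultra (filter_of S p)" "\<forall>\<^sub>F x in filter_of S p. x \<in> S"
proof -
  have p: "S \<in> p" "{} \<notin> p" "\<And>A. A \<subseteq> S \<Longrightarrow> A \<in> p \<or> S - A \<in> p"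
    using assms by (auto simp: beta_def set_ultrafilter_def set_filter_def)
  have "{x \<in> S. \<not> R x} = S - {x \<in> S. R x}" for R by auto
  with p(3)[of "{x \<in> S. _ x}"] p(2) show "ultra (filter_of S p)"
    by (simp add: ultra_def trivial_limit_def eventually_filter_of[OF assms])
  show "\<forall>\<^sub>F x in filter_of S p. x \<in> S" by (simp add: eventually_filter_of[OF assms] p(1))
qed

lemma sets_of_in_beta:
  assumes "ultra P" "\<forall>\<^sub>F x in P. x \<in> S"
  shows "sets_of S P \<in> beta S"
proof -
  have "(\<forall>\<^sub>F x in P. x \<in> B) \<or> (\<forall>\<^sub>F x in P. x \<in> S - B)" for B
  proof (rule disjCI)
    assume "\<not> (\<forall>\<^sub>F x in P. x \<in> S - B)"
    then have "\<forall>\<^sub>F x in P. x \<notin> S - B" using ultra_not[OF assms(1), of "\<lambda>x. x \<in> S - B"] by blast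
    with assms(2) show "\<forall>\<^sub>F x in P. x \<in> B" by eventually_elim simp
  qed
  then show ?thesis
    using assms ultra_not_bot[OF assms(1)]
    by (auto simp: beta_def set_ultrafilter_def set_filter_def sets_of_def eventually_conj_iff
        elim: eventually_mono)
qed

lemma point_in_beta: "x \<in> S \<Longrightarrow> sets_of S (principal {x}) \<in> beta S"
  by (intro sets_of_in_beta ultra_principal) (simp add: eventually_principal)

lemma filter_of_sets_of:
  assumes "ultra P" "\<forall>\<^sub>F x in P. x \<in> S"
  shows "filter_of S (sets_of S P) = P"
  unfolding filter_eq_iff eventually_filter_of[OF sets_of_in_beta[OF assms]]
  using assms(2) by (auto simp: sets_of_def eventually_conj_iff)

lemma sets_of_filter_of:
  assumes "p \<in> beta S"
  shows "sets_of S (filter_of S p) = p"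
proof -
  have "p \<subseteq> Pow S" using assms by (simp add: beta_def set_ultrafilter_def set_filter_def)
  moreover have "{x \<in> S. x \<in> B} = B" if "B \<subseteq> S" for B using that by blast
  ultimately show ?thesis by (auto simp: sets_of_def eventually_filter_of[OF assms])
qed

lemma openin_beta_cls: "B \<subseteq> S \<Longrightarrow> openin (beta_topology S) (beta_cls S B)"
  unfolding beta_topology_def by (rule topology_generated_by_Basis) auto

lemma topspace_beta_topology: "topspace (beta_topology S) = beta S"
proof -
  have "beta_cls S S = beta S"
    by (auto simp: beta_cls_def beta_def set_ultrafilter_def set_filter_def)
  then have "\<Union>(beta_cls S ` Pow S) = beta S" by (auto simp: beta_cls_def)
  then show ?thesis by (simp add: beta_topology_def topology_generated_by_topspace)
qed

section \<open>The corona and the closures of its products\<close>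

lemma X_corona_eq: "X_corona = sets_of UNIV ` {P. ultra P \<and> P \<le> cofinite}"
proof -
  have princ: "principal_ultrafilter \<gamma> = sets_of UNIV (principal {\<gamma>})" for \<gamma> :: 'a
    by (auto simp: principal_ultrafilter_def sets_of_def eventually_principal)
  have inj: "sets_of UNIV P = sets_of UNIV Q \<longleftrightarrow> P = Q" if "ultra P" "ultra Q" for P Q :: "'a filter"
    using filter_of_sets_of[of _ UNIV] that by (metis UNIV_I always_eventually)
  have "sets_of UNIV P \<in> range principal_ultrafilter \<longleftrightarrow> \<not> P \<le> cofinite" if "ultra P" for P :: "'a filter"
  proof -
    have "sets_of UNIV P \<in> range principal_ultrafilter \<longleftrightarrow> (\<exists>\<gamma>. P = principal {\<gamma>})"
      unfolding image_iff princ inj[OF that ultra_principal] by simp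
    then show ?thesis using ultra_eq_principal[OF that] not_principal_le_cofinite by metis
  qed
  moreover have "beta UNIV = sets_of UNIV ` {P :: 'a filter. ultra P}"
  proof (intro equalityI subsetI)
    show "p \<in> sets_of UNIV ` {P. ultra P}" if "p \<in> beta UNIV" for p :: "'a set set"
      using sets_of_filter_of[OF that, symmetric] ultra_filter_of(1)[OF that] by blast
  qed (auto intro: sets_of_in_beta)
  ultimately show ?thesis by (auto simp: X_corona_def)
qed

lemma prod_R_sets_of: "prod_R (sets_of UNIV P) (sets_of UNIV Q) = sets_of UNIV (iterf (+) P Q)"
  by (simp add: prod_R_def sets_of_def eventually_iterf left_translate_eq)

lemma prod_L_sets_of: "prod_L (sets_of UNIV P) (sets_of UNIV Q) = sets_of UNIV (iterf (\<lambda>t s. s + t) Q P)"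
  by (simp add: prod_L_def sets_of_def eventually_iterf right_translate_eq)

lemma beta_cls_disjoint_closure_iff:
  assumes "S \<subseteq> beta UNIV"
  shows "beta_cls UNIV A \<inter> (beta_topology UNIV closure_of S) = {} \<longleftrightarrow> (\<forall>p\<in>S. A \<notin> p)"
  unfolding openin_Int_closure_of_eq_empty[OF openin_beta_cls[OF subset_UNIV]]
  using assms by (auto simp: beta_cls_def)

lemma I_R_eq_I_LTF: "(I_R :: 'a::group_add set set) = I_LTF"
proof -
  have eq: "{prod_R p q |p q :: 'a set set. p \<in> X_corona \<and> q \<in> X_corona} =
      {sets_of UNIV (iterf (+) P Q) |P Q. (ultra P \<and> P \<le> cofinite) \<and> ultra Q \<and> Q \<le> cofinite}"
    unfolding X_corona_eq using prod_R_sets_of by fastforce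
  show ?thesis
    unfolding I_R_def Z_R_def eq I_LTF_def LTF_iff translation_finite_iff
    by (subst beta_cls_disjoint_closure_iff)
      (auto simp: sets_of_in_beta ultra_iterf, (auto simp: sets_of_def)?)
qed

lemma I_L_eq_I_RTF: "(I_L :: 'a::group_add set set) = I_RTF"
proof -
  have eq: "{prod_L p q |p q :: 'a set set. p \<in> X_corona \<and> q \<in> X_corona} =
      {sets_of UNIV (iterf (\<lambda>t s. s + t) Q P) |P Q. (ultra P \<and> P \<le> cofinite) \<and> ultra Q \<and> Q \<le> cofinite}"
    unfolding X_corona_eq using prod_L_sets_of by fastforce
  show ?thesis
    unfolding I_L_def Z_L_def eq I_RTF_def RTF_iff translation_finite_iff
    by (subst beta_cls_disjoint_closure_iff)
      (auto simp: sets_of_in_beta ultra_iterf, (auto simp: sets_of_def)?)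
qed

text \<open>Along \<open>p\<close> itself the principal ultrafilters converge to \<open>p\<close>;
  in particular they are dense in \<open>beta S\<close>.\<close>

lemma eventually_point_in_beta:
  assumes "openin (beta_topology S) T" "p \<in> T"
  shows "\<forall>\<^sub>F x in filter_of S p. sets_of S (principal {x}) \<in> T"
proof -
  have p: "p \<in> beta S" using openin_subset[OF assms(1)] assms(2) by (auto simp: topspace_beta_topology)
  have "generate_topology_on (beta_cls S ` Pow S) T"
    using assms(1) by (simp add: beta_topology_def openin_topology_generated_by_iff)
  then show ?thesis using assms(2)
  proof (induction rule: generate_topology_on.induct)
    case (Int A B)
    then show ?case by (simp add: eventually_conj_iff)
  next
    case (UN K)
    then obtain V where V: "V \<in> K" "p \<in> V" by blast
    from UN.IH[OF V] show ?case by eventually_elim (use V(1) in blast)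
  next
    case (Basis V)
    then obtain B where B: "B \<subseteq> S" "V = beta_cls S B" "B \<in> p" by (auto simp: beta_cls_def)
    then have "B = {x \<in> S. x \<in> B}" by blast
    with B(3) have "\<forall>\<^sub>F x in filter_of S p. x \<in> B" by (simp add: eventually_filter_of[OF p])
    then show ?case
    proof eventually_elim
      case (elim x)
      with B show ?case using point_in_beta[of x S] by (auto simp: beta_cls_def sets_of_def eventually_principal)
    qed
  qed auto
qed

lemma closure_of_points_beta:
  assumes "B \<subseteq> S"
  shows "beta_topology S closure_of ((\<lambda>x. sets_of S (principal {x})) ` B) = beta_cls S B"
proof (intro equalityI closure_of_minimal subsetI)
  show "p \<in> beta_cls S B" if "p \<in> (\<lambda>x. sets_of S (principal {x})) ` B" for p
    using that point_in_beta[of _ S] assms by (auto simp: beta_cls_def sets_of_def eventually_principal)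
  have "beta S - beta_cls S B = beta_cls S (S - B)"
  proof -
    have "S - B \<in> p \<longleftrightarrow> B \<notin> p" if "p \<in> beta S" for p
    proof -
      have "B \<inter> (S - B) = {}" by blast
      moreover have "{} \<notin> p" "\<And>C D. C \<in> p \<Longrightarrow> D \<in> p \<Longrightarrow> C \<inter> D \<in> p" "B \<in> p \<or> S - B \<in> p"
        using that assms by (auto simp: beta_def set_ultrafilter_def set_filter_def)
      ultimately show ?thesis by metis
    qed
    then show ?thesis by (auto simp: beta_cls_def)
  qed
  then show "closedin (beta_topology S) (beta_cls S B)"
    by (auto simp: closedin_def topspace_beta_topology beta_cls_def openin_beta_cls[unfolded beta_cls_def])
next
  fix p assume p: "p \<in> beta_cls S B"
  then have pb: "p \<in> beta S" "B \<in> p" by (auto simp: beta_cls_def)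
  have "{x \<in> S. x \<in> B} = B" using assms by blast
  then have B: "\<forall>\<^sub>F x in filter_of S p. x \<in> B" using pb by (simp add: eventually_filter_of)
  show "p \<in> beta_topology S closure_of ((\<lambda>x. sets_of S (principal {x})) ` B)"
    unfolding in_closure_of topspace_beta_topology
  proof (intro conjI allI impI pb(1))
    fix T assume "p \<in> T \<and> openin (beta_topology S) T"
    then have "\<forall>\<^sub>F x in filter_of S p. sets_of S (principal {x}) \<in> T"
      using eventually_point_in_beta by blast
    with B have "\<forall>\<^sub>F x in filter_of S p. x \<in> B \<and> sets_of S (principal {x}) \<in> T"
      by (rule eventually_conj)
    then show "\<exists>y. y \<in> (\<lambda>x. sets_of S (principal {x})) ` B \<and> y \<in> T"
      using eventually_happens'[OF ultra_not_bot[OF ultra_filter_of(1)[OF pb(1)]]] by blast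
  qed
qed

section \<open>Closures homeomorphic to a Cech-Stone compactification\<close>

lemma continuous_map_beta_Lim:
  fixes f :: "'a \<Rightarrow> complex"
  assumes f: "bounded (range f)"
  shows "continuous_map (beta_topology S) euclidean (\<lambda>p. Lim (filter_of S p) f)"
proof -
  have "openin (beta_topology S) {p \<in> beta S. Lim (filter_of S p) f \<in> U}" if U: "open U" for U
  proof (subst openin_subopen, intro ballI)
    fix p assume "p \<in> {p \<in> beta S. Lim (filter_of S p) f \<in> U}"
    then have p: "p \<in> beta S" "Lim (filter_of S p) f \<in> U" by auto
    then obtain r where r: "r > 0" "ball (Lim (filter_of S p) f) r \<subseteq> U" using U openE by blast
    define B where "B = {x \<in> S. dist (f x) (Lim (filter_of S p) f) < r / 2}"
    have "\<forall>\<^sub>F x in filter_of S p. dist (f x) (Lim (filter_of S p) f) < r / 2"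
      using r by (intro tendstoD[OF ultra_tendsto[OF ultra_filter_of(1)[OF p(1)] f]]) simp
    then have "p \<in> beta_cls S B" using p by (simp add: eventually_filter_of B_def beta_cls_def)
    moreover have "Lim (filter_of S q) f \<in> U" if q: "q \<in> beta_cls S B" for q
    proof -
      have q: "q \<in> beta S" "B \<in> q" using q by (auto simp: beta_cls_def)
      then have "\<forall>\<^sub>F x in filter_of S q. dist (f x) (Lim (filter_of S p) f) < r / 2"
        by (simp add: eventually_filter_of B_def)
      then have "\<forall>\<^sub>F x in filter_of S q. dist (f x) (Lim (filter_of S p) f) \<le> r / 2"
        by (auto elim: eventually_mono)
      then have "dist (Lim (filter_of S q) f) (Lim (filter_of S p) f) \<le> r / 2"
        by (rule tendsto_upperbound[OF
              tendsto_dist[OF ultra_tendsto[OF ultra_filter_of(1)[OF q(1)] f] tendsto_const]])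
          (rule ultra_not_bot[OF ultra_filter_of(1)[OF q(1)]])
      then show ?thesis using r by (auto simp: dist_commute)
    qed
    moreover have "beta_cls S B \<subseteq> beta S" by (auto simp: beta_cls_def)
    moreover have "openin (beta_topology S) (beta_cls S B)"
      by (rule openin_beta_cls) (auto simp: B_def)
    ultimately show "\<exists>T. openin (beta_topology S) T \<and> p \<in> T \<and> T \<subseteq> {p \<in> beta S. Lim (filter_of S p) f \<in> U}"
      by (intro exI[of _ "beta_cls S B"]) auto
  qed
  then show ?thesis by (simp add: continuous_map_def topspace_beta_topology)
qed

text \<open>All subsets of \<open>A\<close> have indicators in \<open>WAP\<close>, so a point of the
  closure determines its ultrafilter on \<open>A\<close> by its values on them. This is
  \<open>k\<close>; its inverse \<open>j\<close> is evaluation. The preimage of a basic open set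
  under \<open>k\<close> is the open closure of a subset, and \<open>j\<close> is continuous in each
  coordinate.\<close>

lemma I_TF_subset_I_IW: "(I_TF :: 'a::{group_add,countable,discrete_topology} set set) \<subseteq> I_IW"
proof
  fix A :: "'a set" assume A: "A \<in> I_TF"
  note W = linf_ind_WAP[OF A]
  note WA = W[OF order.refl]
  define k where "k \<xi> = {B. B \<subseteq> A \<and> \<xi> (linf_ind B) = 1}" for \<xi> :: "'a linf \<Rightarrow> complex"
  define j where "j p = wap_ev (filter_of A p)" for p
  note sub = wap_cls_subset[of A]
  then have top: "topspace (subtopology wap_topology (wap_cls A)) = wap_cls A"
    by (auto simp: topspace_subtopology topspace_wap_topology)
  have cls: "\<exists>P. ultra P \<and> (\<forall>\<^sub>F x in P. x \<in> A) \<and> \<xi> = wap_ev P" if \<xi>: "\<xi> \<in> wap_cls A" for \<xi>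
  proof -
    obtain P where "ultra P" "\<xi> = wap_ev P" using \<xi> sub unfolding wap_space_eq_range_ev by blast
    with \<xi> show ?thesis using wap_ev_in_wap_cls_iff[OF WA] by blast
  qed
  have k_ev: "k (wap_ev P) = sets_of A P" if "ultra P" for P
    using that wap_cls_eq[OF W] wap_ev_in_wap_cls_iff[OF W] wap_ev_in_wap_space[OF that]
    unfolding k_def sets_of_def by blast
  have j_cls: "j p \<in> wap_cls A" if "p \<in> beta A" for p
    unfolding j_def by (intro wap_ev_in_wap_cls ultra_filter_of that)
  have k_cont: "continuous_map (subtopology wap_topology (wap_cls A)) (beta_topology A) k"
    unfolding beta_topology_def
  proof (intro continuous_on_generated_topo)
    fix V assume "V \<in> beta_cls A ` Pow A"
    then obtain B where B: "B \<subseteq> A" "V = beta_cls A B" by auto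
    have "k \<xi> \<in> V \<longleftrightarrow> \<xi> \<in> wap_cls B" if \<xi>: "\<xi> \<in> wap_cls A" for \<xi>
    proof -
      from cls[OF \<xi>] obtain P where P: "ultra P" "\<forall>\<^sub>F x in P. x \<in> A" "\<xi> = wap_ev P" by blast
      then show ?thesis
        using sets_of_in_beta[OF P(1,2)] B
        by (simp add: k_ev beta_cls_def sets_of_def wap_ev_in_wap_cls_iff[OF W])
    qed
    then have "k -` V \<inter> wap_cls A = wap_cls B \<inter> wap_cls A" by blast
    then show "openin (subtopology wap_topology (wap_cls A))
        (k -` V \<inter> topspace (subtopology wap_topology (wap_cls A)))"
      unfolding top by (auto simp: openin_subtopology intro: openin_wap_cls[OF W[OF B(1)]])
  next
    have "k \<xi> \<in> beta A" if \<xi>: "\<xi> \<in> wap_cls A" for \<xi>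
      using cls[OF \<xi>] by (auto simp: k_ev sets_of_in_beta)
    moreover have "\<Union>(beta_cls A ` Pow A) = beta A"
      using topspace_beta_topology[of A] by (simp add: beta_topology_def topology_generated_by_topspace)
    ultimately show "k ` topspace (subtopology wap_topology (wap_cls A)) \<subseteq> \<Union>(beta_cls A ` Pow A)"
      unfolding top by auto
  qed
  have "continuous_map (beta_topology A) (product_topology (\<lambda>_. euclidean) WAP) j"
    unfolding continuous_map_componentwise
    by (auto simp: j_def wap_ev_def intro!: continuous_map_beta_Lim bounded_range_linf)
  then have j_cont: "continuous_map (beta_topology A) (subtopology wap_topology (wap_cls A)) j"
    using j_cls sub unfolding wap_topology_def
    by (auto simp: continuous_map_in_subtopology topspace_beta_topology)
  have "homeomorphic_maps (subtopology wap_topology (wap_cls A)) (beta_topology A) k j"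
    unfolding homeomorphic_maps_def
  proof (intro conjI k_cont j_cont ballI)
    fix \<xi> assume "\<xi> \<in> topspace (subtopology wap_topology (wap_cls A))"
    then obtain P where "ultra P" "\<forall>\<^sub>F x in P. x \<in> A" "\<xi> = wap_ev P"
      using cls unfolding top by blast
    then show "j (k \<xi>) = \<xi>" by (simp add: k_ev j_def filter_of_sets_of)
  next
    fix p assume "p \<in> topspace (beta_topology A)"
    then show "k (j p) = p"
      by (simp add: topspace_beta_topology j_def k_ev ultra_filter_of sets_of_filter_of)
  qed
  then show "A \<in> I_IW"
    using openin_wap_cls[OF WA] by (auto simp: I_IW_def homeomorphic_space_def)
qed

text \<open>
  A homeomorphism onto \<open>\<beta>A\<close> permutes the isolated points, so it carries the closure of each
  \<open>B \<subseteq> A\<close> to a basic open set of \<open>\<beta>A\<close>.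
\<close>

lemma I_IW_subset_I_TF: "(I_IW :: 'a::{group_add,countable,discrete_topology} set set) \<subseteq> I_TF"
proof
  fix A :: "'a set" assume A: "A \<in> I_IW"
  define X where "X = subtopology wap_topology (wap_cls A)"
  obtain f where f: "homeomorphic_map X (beta_topology A) f"
    using A by (auto simp: I_IW_def X_def homeomorphic_space)
  note sub = wap_cls_subset[of A]
  then have top: "topspace X = wap_cls A"
    by (auto simp: X_def topspace_subtopology topspace_wap_topology)
  define pt where "pt x = sets_of A (principal {x})" for x
  have iso: "\<exists>b\<in>A. f (wap_point a) = pt b" if a: "a \<in> A" for a
  proof -
    have aA: "wap_point a \<in> wap_cls A" using a by (simp add: wap_point_in_wap_cls_iff)
    then have "openin X {wap_point a}"
      using openin_wap_point[of a] by (auto simp: X_def openin_subtopology intro!: exI[of _ "{wap_point a}"])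
    \<comment> \<open>The image of an isolated point is isolated, and an isolated point of
      \<open>beta A\<close> is principal because the principal ultrafilters are dense.\<close>
    then have op: "openin (beta_topology A) {f (wap_point a)}"
      using homeomorphic_map_openness[OF f, of "{wap_point a}"] aA by (simp add: top)
    then have p: "f (wap_point a) \<in> beta A"
      using openin_subset by (fastforce simp: topspace_beta_topology)
    have "\<forall>\<^sub>F x in filter_of A (f (wap_point a)). x \<in> A \<and> pt x = f (wap_point a)"
      using eventually_point_in_beta[OF op] ultra_filter_of(2)[OF p] by (simp add: pt_def eventually_conj_iff)
    from eventually_happens'[OF ultra_not_bot[OF ultra_filter_of(1)[OF p]] this]
    show ?thesis by force
  qed
  have "openin wap_topology (wap_cls B)" if B: "B \<subseteq> A" for B
  proof -
    define B' where "B' = {b \<in> A. pt b \<in> f ` wap_point ` B}"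
    have B': "f ` wap_point ` B = pt ` B'" using iso B by (fastforce simp: B'_def)
    have BA: "wap_point ` B \<subseteq> wap_cls A" using B by (auto simp: wap_point_in_wap_cls_iff)
    have "f ` (X closure_of (wap_point ` B)) = beta_topology A closure_of (pt ` B')"
      using homeomorphic_map_closure_of[OF f, of "wap_point ` B"] BA by (simp add: top B')
    also have "\<dots> = beta_cls A B'"
      unfolding pt_def by (rule closure_of_points_beta) (auto simp: B'_def)
    finally have "openin (beta_topology A) (f ` (X closure_of (wap_point ` B)))"
      by (simp add: openin_beta_cls B'_def)
    then have "openin X (X closure_of (wap_point ` B))"
      using homeomorphic_map_openness[OF f closure_of_subset_topspace] by simp
    moreover have "X closure_of (wap_point ` B) = wap_cls B"
    proof -
      have "wap_cls B \<subseteq> wap_cls A"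
        unfolding wap_cls_def using B by (intro closure_of_mono image_mono)
      then show ?thesis
        unfolding X_def closure_of_subtopology using BA by (auto simp: wap_cls_def Int_absorb1)
    qed
    \<comment> \<open>Openness inside the subspace \<open>X\<close> passes to the whole
      compactification because \<open>X\<close> sits on an open set.\<close>
    moreover have "openin wap_topology (wap_cls A)" using A by (simp add: I_IW_def)
    ultimately show ?thesis unfolding X_def by (simp add: openin_open_subtopology)
  qed
  then show "A \<in> I_TF" by (rule I_TF_if_openin_wap_cls)
qed

theorem theorem2p3:
  assumes "infinite (UNIV :: 'a::{group_add,countable,discrete_topology} set)"
  shows
    "((F_R :: 'a set set) = F_LTF \<and> set_filter UNIV (F_LTF :: 'a set set)) \<and>
     ((F_L :: 'a set set) = F_RTF \<and> set_filter UNIV (F_RTF :: 'a set set)) \<and>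
     ((F_RL :: 'a set set) = F_TF \<and> (F_TF :: 'a set set) = F_RTF \<inter> F_LTF \<and>
      (I_TF :: 'a set set) = I_LTF \<inter> I_RTF \<and>
      (I_LTF :: 'a set set) \<inter> I_RTF = I_L \<inter> I_R \<and>
      (I_L :: 'a set set) \<inter> I_R = I_RL \<and>
      (I_RL :: 'a set set) = I_W \<and>
      (I_W :: 'a set set) = I_IW)"
proof -
  have RL: "(I_RL :: 'a set set) = I_L \<inter> I_R"
    by (auto simp: I_RL_def I_L_def I_R_def Z_RL_def)
  have TF: "(I_RL :: 'a set set) = I_TF"
    unfolding RL I_R_eq_I_LTF I_L_eq_I_RTF I_TF_def by blast
  have "(I_IW :: 'a set set) = I_TF"
    using I_TF_subset_I_IW I_IW_subset_I_TF by blast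
  moreover have "set_filter UNIV (F_LTF :: 'a set set)" "set_filter UNIV (F_RTF :: 'a set set)"
    using set_filter_translation_finite[OF assms assms]
    by (simp_all add: F_LTF_def F_RTF_def I_LTF_def I_RTF_def LTF_iff RTF_iff)
  ultimately show ?thesis
    using RL TF I_TF_eq_I_W[where 'a = 'a] I_R_eq_I_LTF[where 'a = 'a] I_L_eq_I_RTF[where 'a = 'a]
    by (auto simp: F_R_def F_L_def F_RL_def F_TF_def F_LTF_def F_RTF_def I_TF_def)
qed

end
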